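(* Let $T=[v_0,v_1,v_2,v_3]\subset\mathbb R^3$ be a tetrahedron and for each edge $e_{\ell m}=[v_\ell,v_m]$, $0\le\ell<m\le3$, let $\gamma_{\ell m}^0,\gamma_{\ell m}^1\in e_{\ell m}^\perp$ be linearly independent. Then the degrees of freedom $$z(v_i),\quad\nabla z(v_i)\quad(i=0,\dots,3),\qquad \mathcal E_{\ell m}^j(z)=4\,\nabla z(\mathrm{mid}(e_{\ell m}))\cdot\gamma_{\ell m}^j\quad(j=0,1,\ 0\le\ell<m\le3)$$ are unisolvent for $Z_3^{\mathrm{sing}}(T)$ (i.e. the linear map from $Z_3^{\mathrm{sing}}(T)$ to $\mathbb R^{28}$ given by these degrees of freedom is bijective), and $$\dim Z_3^{\mathrm{sing}}(T)=28.$$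
   Context: $T=[v_0,v_1,v_2,v_3]\subset\mathbb R^3$ is a (nondegenerate) tetrahedron with barycentric coordinates $\lambda_0,\dots,\lambda_3$. Set $I=\{0,1,2,3\}$, $J_i=I\setminus\{i\}$. Let $f_i=\{\lambda_i=0\}$ be the face opposite to $v_i$, $\nu_i$ its outer unit normal, and $d_{ji}=\nabla\lambda_j\cdot\nu_i$. For an edge $e$, $\mathrm{mid}(e)$ is its midpoint and $e^\perp=\{\nu\in\mathbb R^3:\nu\perp e\}$. $\mathcal P_k$ denotes polynomials of total degree at most $k$. Polynomial Zienkiewicz space: $Z_3^0(T)=\mathcal P_2(T)\oplus\mathrm{span}\{\lambda_i^2\lambda_j-\lambda_j^2\lambda_i:0\le i<j\le3\}$. Singular edge bubbles: for $0\le\ell<m\le3$ and $n\in I\setminus\{\ell,m\}$, $$E_{\ell m}^n=\frac{\lambda_n\lambda_\ell^2\lambda_m^2}{(\lambda_n+\lambda_\ell)(\lambda_n+\lambda_m)}.$$ Edge-enriched space: $Z_3^e(T)=Z_3^0(T)+\mathrm{span}\{E_{\ell m}^n:0\le\ell<m\le3,\ n\in I\setminus\{\ell,m\}\}$. On the face $f_i$ put $\mu_j=\lambda_j|_{f_i}$ for $j\in J_i$. For an edge $e_{\ell m}\subset f_i$ ($\ell<m$) with $\{n\}=I\setminus\{i,\ell,m\}$ set $$\Phi_{\ell m,\ell}^{n,i}=\frac{\mu_n\mu_\ell\mu_m^2(2\mu_n+\mu_\ell)}{(\mu_n+\mu_\ell)^2(\mu_n+\mu_m)},\quad \Phi_{\ell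 m,m}^{n,i}=\frac{\mu_n\mu_\ell^2\mu_m(2\mu_n+\mu_m)}{(\mu_n+\mu_\ell)(\mu_n+\mu_m)^2},$$ $$\Phi_{\ell m,n}^{n,i}=\frac{\mu_\ell^2\mu_m^2(\mu_\ell\mu_m-\mu_n^2)}{(\mu_n+\mu_\ell)^2(\mu_n+\mu_m)^2}-\mu_\ell\mu_m,$$ and let $Q_{\mathrm{edge}}(f_i)$ be the span of these functions over all edges $e_{\ell m}\subset f_i$. For $q\in Q_{\mathrm{edge}}(f_i)$ the canonical barycentric extension $\widetilde q$ to $T$ is obtained by replacing $\mu_j$ by $\lambda_j$ for all $j\in J_i$ in these formulas (extended linearly). The normal lift is $$L_iq=\frac{\lambda_i}{d_{ii}}\Theta_i\,\widetilde q,\qquad \Theta_i=\prod_{j\in J_i}\frac{\lambda_j}{\lambda_i+\lambda_j}.$$ Every $z\in Z_3^e(T)$ has on each face a unique decomposition $\partial_{\nu_i}z|_{f_i}=p_i(z)+q_i(z)$ with $p_i(z)\in\mathcal P_2(f_i)$, $q_i(z)\in Q_{\mathrm{edge}}(f_i)$. Set $\mathcal R_Tz=z-\sum_{i=0}^3L_iq_i(z)$ and $$Z_3^{\mathrm{sing}}(T)=\mathcal R_TZ_3^e(T).$$ Values and gradients at points of $\partial T$ are understood by continuous extension. *)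

theory Defs
  imports "HOL-Analysis.Analysis" "HOL-Library.Function_Algebras"
begin

text \<open>Real-valued functions form a real vector space under pointwise operations; this makes
  \<^term>\<open>span\<close>, \<^term>\<open>subspace\<close> and \<^term>\<open>dim\<close> available for function spaces.\<close>

instantiation "fun" :: (type, real_vector) real_vector
begin

definition scaleR_fun :: "real \<Rightarrow> ('a \<Rightarrow> 'b) \<Rightarrow> 'a \<Rightarrow> 'b"
  where "scaleR_fun c f = (\<lambda>x. c *\<^sub>R f x)"

instance
  by standard (simp_all add: scaleR_fun_def fun_eq_iff scaleR_add_right scaleR_add_left)

end

lemma scaleR_fun_apply [simp]: "(c *\<^sub>R f) x = c *\<^sub>R f x"
  by (simp add: scaleR_fun_def)


text \<open>A function on a set \<open>S\<close> is represented by the total function vanishing off \<open>S\<close>, so that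
  equality of representatives is equality on \<open>S\<close>.\<close>

definition restr :: "'a set \<Rightarrow> ('a \<Rightarrow> real) \<Rightarrow> 'a \<Rightarrow> real"
  where "restr S f = (\<lambda>x. if x \<in> S then f x else 0)"

definition grad :: "(real^3 \<Rightarrow> real) \<Rightarrow> real^3 \<Rightarrow> real^3"
  where "grad f x = (THE D. GDERIV f x :> D)"

definition polys_on :: "(real^3) set \<Rightarrow> nat \<Rightarrow> (real^3 \<Rightarrow> real) set"
  where "polys_on S k =
    span {restr S (\<lambda>x. \<Prod>j\<in>UNIV. (x $ j) ^ a j) | a :: 3 \<Rightarrow> nat. (\<Sum>j\<in>UNIV. a j) \<le> k}"


text \<open>The vertices are \<open>v 0, \<dots>, v 3\<close>; the values \<open>v i\<close> for \<open>i > 3\<close> play no role.\<close>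

definition nondegenerate :: "(nat \<Rightarrow> real^3) \<Rightarrow> bool"
  where "nondegenerate v \<longleftrightarrow> inj_on v {..3} \<and> \<not> affine_dependent (v ` {..3})"

definition tet :: "(nat \<Rightarrow> real^3) \<Rightarrow> (real^3) set"
  where "tet v = convex hull (v ` {..3})"

definition bary :: "(nat \<Rightarrow> real^3) \<Rightarrow> nat \<Rightarrow> real^3 \<Rightarrow> real"
  where "bary v j x =
    (THE t. \<exists>c. c j = t \<and> (\<Sum>k\<le>3. c k) = 1 \<and> (\<Sum>k\<le>3. c k *\<^sub>R v k) = x)"

definition face :: "(nat \<Rightarrow> real^3) \<Rightarrow> nat \<Rightarrow> (real^3) set"
  where "face v i = {x \<in> tet v. bary v i x = 0}"

definition outer_normal :: "(nat \<Rightarrow> real^3) \<Rightarrow> nat \<Rightarrow> real^3"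
  where "outer_normal v i =
    (THE \<nu>. norm \<nu> = 1 \<and> (\<forall>x\<in>face v i. \<forall>y\<in>face v i. \<nu> \<bullet> (x - y) = 0)
          \<and> (\<forall>y\<in>face v i. \<nu> \<bullet> (v i - y) < 0))"

text \<open>\<open>dnu v j i\<close> is \<open>d\<^bsub>ji\<^esub>\<close>; the gradient of a barycentric coordinate is constant, so the
  evaluation point is immaterial.\<close>

definition dnu :: "(nat \<Rightarrow> real^3) \<Rightarrow> nat \<Rightarrow> nat \<Rightarrow> real"
  where "dnu v j i = grad (bary v j) (v i) \<bullet> outer_normal v i"

definition edge_perp :: "(nat \<Rightarrow> real^3) \<Rightarrow> nat \<Rightarrow> nat \<Rightarrow> (real^3) set"
  where "edge_perp v l m = {\<nu>. orthogonal \<nu> (v m - v l)}"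


text \<open>The rational functions below have no removable or other singularities in the interior
  of \<open>T\<close>, so functions on \<open>T\<close> are represented on the interior, and their values and gradients
  at boundary points are defined as limits from the interior.\<close>

definition bd_val :: "(nat \<Rightarrow> real^3) \<Rightarrow> (real^3 \<Rightarrow> real) \<Rightarrow> real^3 \<Rightarrow> real"
  where "bd_val v z p = Lim (at p within interior (tet v)) z"

definition bd_grad :: "(nat \<Rightarrow> real^3) \<Rightarrow> (real^3 \<Rightarrow> real) \<Rightarrow> real^3 \<Rightarrow> real^3"
  where "bd_grad v z p = Lim (at p within interior (tet v)) (grad z)"

definition Z30 :: "(nat \<Rightarrow> real^3) \<Rightarrow> (real^3 \<Rightarrow> real) set"
  where "Z30 v =
    {p + b | p b. p \<in> polys_on (interior (tet v)) 2 \<and>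
      b \<in> span {restr (interior (tet v))
                   (\<lambda>x. (bary v i x)\<^sup>2 * bary v j x - (bary v j x)\<^sup>2 * bary v i x)
                | i j. i < j \<and> j \<le> 3}}"

definition edge_bubble :: "(nat \<Rightarrow> real^3) \<Rightarrow> nat \<Rightarrow> nat \<Rightarrow> nat \<Rightarrow> real^3 \<Rightarrow> real"
  where "edge_bubble v l m n x =
    bary v n x * (bary v l x)\<^sup>2 * (bary v m x)\<^sup>2 /
      ((bary v n x + bary v l x) * (bary v n x + bary v m x))"

definition Z3e :: "(nat \<Rightarrow> real^3) \<Rightarrow> (real^3 \<Rightarrow> real) set"
  where "Z3e v =
    {z + b | z b. z \<in> Z30 v \<and>
      b \<in> span {restr (interior (tet v)) (edge_bubble v l m n)
                | l m n. l < m \<and> m \<le> 3 \<and> n \<in> {..3} - {l, m}}}"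


text \<open>\<open>Phi (l, m, n, k) \<mu>\<close> is \<open>\<Phi>\<^bsub>lm,k\<^esub>\<close> (with third index \<open>n\<close>) as a formula in the variables
  \<open>\<mu>\<close>. Inserting the barycentric coordinates on a face gives the face function, inserting them
  on \<open>T\<close> its canonical extension. On a closed face the denominators vanish only at vertices, where
  division by zero gives the value \<open>0\<close>, which is also the continuous extension.\<close>

fun Phi :: "nat \<times> nat \<times> nat \<times> nat \<Rightarrow> (nat \<Rightarrow> real) \<Rightarrow> real"
  where "Phi (l, m, n, k) \<mu> =
   (if k = l then
      \<mu> n * \<mu> l * (\<mu> m)\<^sup>2 * (2 * \<mu> n + \<mu> l) / ((\<mu> n + \<mu> l)\<^sup>2 * (\<mu> n + \<mu> m))
    else if k = m then
      \<mu> n * (\<mu> l)\<^sup>2 * \<mu> m * (2 * \<mu> n + \<mu> m) / ((\<mu> n + \<mu> l) * (\<mu> n + \<mu> m)\<^sup>2)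
    else
      (\<mu> l)\<^sup>2 * (\<mu> m)\<^sup>2 * (\<mu> l * \<mu> m - (\<mu> n)\<^sup>2) / ((\<mu> n + \<mu> l)\<^sup>2 * (\<mu> n + \<mu> m)\<^sup>2)
        - \<mu> l * \<mu> m)"

definition face_index :: "nat \<Rightarrow> (nat \<times> nat \<times> nat \<times> nat) set"
  where "face_index i =
    {(l, m, n, k). l < m \<and> m \<le> 3 \<and> l \<noteq> i \<and> m \<noteq> i \<and>
                   n \<in> {..3} - {i, l, m} \<and> k \<in> {l, m, n}}"

definition Phi_sum ::
    "(nat \<Rightarrow> real^3) \<Rightarrow> nat \<Rightarrow> (nat \<times> nat \<times> nat \<times> nat \<Rightarrow> real) \<Rightarrow> real^3 \<Rightarrow> real"
  where "Phi_sum v i c x = (\<Sum>t\<in>face_index i. c t * Phi t (\<lambda>j. bary v j x))"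

definition Q_edge :: "(nat \<Rightarrow> real^3) \<Rightarrow> nat \<Rightarrow> (real^3 \<Rightarrow> real) set"
  where "Q_edge v i =
    span {restr (face v i) (\<lambda>x. Phi t (\<lambda>j. bary v j x)) | t. t \<in> face_index i}"

text \<open>The nine functions spanning \<open>Q_edge v i\<close> are linearly independent on the face, so the
  coefficients of \<open>q\<close> selected here are unique on \<open>face_index i\<close>.\<close>

definition bary_ext :: "(nat \<Rightarrow> real^3) \<Rightarrow> nat \<Rightarrow> (real^3 \<Rightarrow> real) \<Rightarrow> real^3 \<Rightarrow> real"
  where "bary_ext v i q = Phi_sum v i (SOME c. q = restr (face v i) (Phi_sum v i c))"

definition Theta :: "(nat \<Rightarrow> real^3) \<Rightarrow> nat \<Rightarrow> real^3 \<Rightarrow> real"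
  where "Theta v i x = (\<Prod>j\<in>{..3} - {i}. bary v j x / (bary v i x + bary v j x))"

definition normal_lift :: "(nat \<Rightarrow> real^3) \<Rightarrow> nat \<Rightarrow> (real^3 \<Rightarrow> real) \<Rightarrow> real^3 \<Rightarrow> real"
  where "normal_lift v i q =
    restr (interior (tet v)) (\<lambda>x. bary v i x / dnu v i i * Theta v i x * bary_ext v i q x)"

definition q_part :: "(nat \<Rightarrow> real^3) \<Rightarrow> nat \<Rightarrow> (real^3 \<Rightarrow> real) \<Rightarrow> real^3 \<Rightarrow> real"
  where "q_part v i z =
    (THE q. q \<in> Q_edge v i \<and>
       (\<exists>p\<in>polys_on (face v i) 2.
          restr (face v i) (\<lambda>x. bd_grad v z x \<bullet> outer_normal v i) = p + q))"

definition R_T :: "(nat \<Rightarrow> real^3) \<Rightarrow> (real^3 \<Rightarrow> real) \<Rightarrow> real^3 \<Rightarrow> real"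
  where "R_T v z = z - (\<Sum>i\<le>3. normal_lift v i (q_part v i z))"

definition Z3sing :: "(nat \<Rightarrow> real^3) \<Rightarrow> (real^3 \<Rightarrow> real) set"
  where "Z3sing v = R_T v ` Z3e v"


definition vertex_dofs :: "(nat \<Rightarrow> real^3) \<Rightarrow> (real^3 \<Rightarrow> real) \<Rightarrow> nat \<Rightarrow> real list"
  where "vertex_dofs v z i =
    [bd_val v z (v i), bd_grad v z (v i) $ 1, bd_grad v z (v i) $ 2, bd_grad v z (v i) $ 3]"

definition edge_dof ::
    "(nat \<Rightarrow> real^3) \<Rightarrow> (nat \<Rightarrow> nat \<Rightarrow> nat \<Rightarrow> real^3) \<Rightarrow> (real^3 \<Rightarrow> real) \<Rightarrow>
     nat \<Rightarrow> nat \<Rightarrow> nat \<Rightarrow> real"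
  where "edge_dof v \<gamma> z l m j = 4 * (bd_grad v z (midpoint (v l) (v m)) \<bullet> \<gamma> l m j)"

definition dofs ::
    "(nat \<Rightarrow> real^3) \<Rightarrow> (nat \<Rightarrow> nat \<Rightarrow> nat \<Rightarrow> real^3) \<Rightarrow> (real^3 \<Rightarrow> real) \<Rightarrow> real^28"
  where "dofs v \<gamma> z = vector
    (concat (map (vertex_dofs v z) [0, 1, 2, 3]) @
     concat (map (\<lambda>(l, m). [edge_dof v \<gamma> z l m 0, edge_dof v \<gamma> z l m 1])
       [(0, 1), (0, 2), (0, 3), (1, 2), (1, 3), (2, 3)]))"

end

theory Submission
  imports Defs
begin

text \<open>The normal lifts that are subtracted in \<^term>\<open>R_T\<close> are invisible to the degrees of freedom: a lift
  and its gradient tend to zero at every vertex and at every edge midpoint. Hence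
  \<open>dofs (R_T z) = dofs z\<close>, and since \<^term>\<open>R_T\<close> is linear on \<open>Z3e\<close> it suffices that the degrees of
  freedom are unisolvent for the unmodified space \<open>Z3e\<close>; injectivity of \<^term>\<open>R_T\<close> then comes for free.

  \<^bold>\<open>Unisolvence for \<open>Z3e\<close>.\<close> An element is a combination of the products \<open>\<lambda>\<^sub>i\<lambda>\<^sub>j\<close> (\<open>i \<le> j\<close>), the skew
  cubics \<open>\<lambda>\<^sub>i\<^sup>2\<lambda>\<^sub>j - \<lambda>\<^sub>j\<^sup>2\<lambda>\<^sub>i\<close> (\<open>i < j\<close>) and the edge bubbles. The bubbles vanish with their gradients at the
  vertices, so the vertex data see only the first two families: the value at \<open>v\<^sub>k\<close> is the coefficient of
  \<open>\<lambda>\<^sub>k\<^sup>2\<close>, and once these are known the derivatives along an edge at its two ends give the sum and the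
  difference of the two coefficients that belong to the edge (\<open>enriched_vertex\<close>, \<open>enriched_grad_vertex\<close>). At the midpoint of an
  edge the only bubbles with a nonzero gradient are the two of that edge, with gradients
  \<open>\<nabla>\<lambda>\<^sub>n / 4\<close> for the two vertices \<open>v\<^sub>n\<close> off the edge (\<open>enriched_grad_midpoint\<close>). These two vectors form a
  basis of the plane perpendicular to the edge, so testing with a basis of that plane gives an
  invertible \<open>2 \<times> 2\<close> system for the two coefficients (\<open>edge_combination_eq_0\<close>,
  \<open>edge_combination_exists\<close>).

  \<^bold>\<open>Well-definedness of \<^term>\<open>R_T\<close>.\<close> The partial derivatives of a bubble extend continuously to the closed
  tetrahedron, and on a face they are \<^term>\<open>Phi\<close> functions, a quadratic monomial, or a sum of both. This
  yields the decomposition of the normal derivative (\<open>normal_derivative_in_face_traces\<close>). It is unique because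
  every element of \<^term>\<open>Q_edge\<close> vanishes on the boundary of the face, while a quadratic polynomial is
  determined by its values at the vertices and edge midpoints of the face (\<open>polys_on_Int_Q_edge\<close>). The
  barycentric extension is linear because every \<^term>\<open>Phi\<close> is homogeneous of degree two, so that the
  extension is determined by the face function itself (\<open>bary_ext_scaling\<close>).

  \<^bold>\<open>Flatness of the lifts.\<close> Up to sign, each \<^term>\<open>Phi\<close> is built from positive barycentric coordinates by
  sums, products and quotients alone. For such a function \<open>f\<close> all \<open>\<lambda>\<^sub>k \<partial>\<^sub>k f\<close> are bounded by a multiple of
  \<open>f\<close>, which turns size estimates into gradient estimates (\<open>has_bd_jet_flat\<close>). As \<open>\<bar>Phi\<bar>\<close> is at most
  \<open>2abc / ((a + b)(a + c))\<close> in the three coordinates of the face, where \<open>a\<close> belongs to the vertex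
  opposite to the edge, a lift is bounded by a multiple of
  \<open>\<lambda>\<^sub>k \<lambda>\<^sub>j\<close> for every \<open>k\<close> and every \<open>j \<noteq> i\<close>. A point on an edge has two vanishing coordinates, one of
  which has an index \<open>j \<noteq> i\<close>, and so the gradient of the lift tends to zero there.\<close>

section \<open>Barycentric coordinates\<close>

lemma inner_functional_eqD:
  fixes D :: "'a::real_inner"
  assumes "(\<lambda>h. h \<bullet> D) = (\<lambda>h. h \<bullet> E)"
  shows "D = E"
  using fun_cong[OF assms, of "D - E"] inner_eq_zero_iff[of "D - E"] by (simp add: inner_diff_right)

locale tetrahedron =
  fixes v :: "nat \<Rightarrow> real^3"
  assumes nondeg: "nondegenerate v"
begin

abbreviation Int_T :: "(real^3) set"
  where "Int_T \<equiv> interior (tet v)"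

text \<open>The gradient \<open>\<nabla>\<lambda>\<^sub>i\<close>; it is constant, and \<open>0\<close> is an arbitrary evaluation point.\<close>

definition glam :: "nat \<Rightarrow> real^3"
  where "glam i = grad (bary v i) 0"

lemma inj_v: "inj_on v {..3}"
  using nondeg by (simp add: nondegenerate_def)

lemma sum_over_vertices:
  fixes h :: "real^3 \<Rightarrow> 'b::comm_monoid_add"
  shows "(\<Sum>s\<in>v ` {..3}. h s) = (\<Sum>k\<le>3. h (v k))"
  by (rule sum.reindex[OF inj_v, unfolded o_def])

lemma affine_hull_vertices: "affine hull (v ` {..3}) = UNIV"
proof (rule affine_independent_span_eq)
  show "\<not> affine_dependent (v ` {..3})"
    using nondeg by (simp add: nondegenerate_def)
  show "card (v ` {..3}) = Suc DIM(real^3)"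
    by (simp add: card_image[OF inj_v])
qed

lemma barycentric_unique:
  assumes "(\<Sum>k\<le>3. c k) = (1::real)" "(\<Sum>k\<le>3. d k) = 1"
    and eq: "(\<Sum>k\<le>3. c k *\<^sub>R v k) = (\<Sum>k\<le>3. d k *\<^sub>R v k)" and "j \<le> 3"
  shows "c j = d j"
proof (rule ccontr)
  assume ne: "c j \<noteq> d j"
  define U where "U s = (c - d) (inv_into {..3} v s)" for s
  have U: "U (v k) = c k - d k" if "k \<le> 3" for k
    using that by (simp add: U_def inv_into_f_f[OF inj_v])
  have "sum U (v ` {..3}) = 0"
    unfolding sum_over_vertices using assms(1,2) by (simp add: U sum_subtractf)
  moreover have "(\<Sum>s\<in>v ` {..3}. U s *\<^sub>R s) = 0"
    unfolding sum_over_vertices using eq by (simp add: U scaleR_diff_left sum_subtractf)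
  moreover have "\<exists>s\<in>v ` {..3}. U s \<noteq> 0"
    using \<open>j \<le> 3\<close> ne by (auto simp: U)
  ultimately have "affine_dependent (v ` {..3})"
    by (subst affine_dependent_explicit_finite) auto
  then show False
    using nondeg by (simp add: nondegenerate_def)
qed

lemma bary_eqI:
  assumes "(\<Sum>k\<le>3. c k) = 1" "(\<Sum>k\<le>3. c k *\<^sub>R v k) = x" "j \<le> 3"
  shows "bary v j x = c j"
  unfolding bary_def
proof (rule the_equality)
  show "\<exists>c'. c' j = c j \<and> sum c' {..3} = 1 \<and> (\<Sum>k\<le>3. c' k *\<^sub>R v k) = x"
    using assms by blast
  show "t = c j" if "\<exists>c. c j = t \<and> sum c {..3} = 1 \<and> (\<Sum>k\<le>3. c k *\<^sub>R v k) = x" for t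
    using that barycentric_unique[OF _ assms(1) _ \<open>j \<le> 3\<close>] assms(2) by metis
qed

lemma bary_sums: "(\<Sum>k\<le>3. bary v k x) = 1" "(\<Sum>k\<le>3. bary v k x *\<^sub>R v k) = x"
proof -
  have "x \<in> affine hull (v ` {..3})"
    by (simp add: affine_hull_vertices)
  then obtain u where u: "sum u (v ` {..3}) = 1" "(\<Sum>s\<in>v ` {..3}. u s *\<^sub>R s) = x"
    by (auto simp: affine_hull_finite)
  then have *: "(\<Sum>k\<le>3. u (v k)) = 1" "(\<Sum>k\<le>3. u (v k) *\<^sub>R v k) = x"
    by (simp_all add: sum_over_vertices)
  have b: "bary v j x = u (v j)" if "j \<le> 3" for j
    using bary_eqI[OF *  that] .
  show "(\<Sum>k\<le>3. bary v k x) = 1" "(\<Sum>k\<le>3. bary v k x *\<^sub>R v k) = x"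
    using * b by simp_all
qed

text \<open>Barycentric coordinates are affine, because combining the representations of the points gives a
  representation of the combined point and representations are unique.\<close>

lemma bary_affine_combination:
  assumes "(\<Sum>k\<in>K. w k) = (1::real)" "j \<le> 3"
  shows "bary v j (\<Sum>k\<in>K. w k *\<^sub>R y k) = (\<Sum>k\<in>K. w k * bary v j (y k))"
proof -
  have "bary v j (\<Sum>k\<in>K. w k *\<^sub>R y k) = (\<lambda>i. \<Sum>k\<in>K. w k * bary v i (y k)) j"
  proof (rule bary_eqI)
    show "(\<Sum>i\<le>3. \<Sum>k\<in>K. w k * bary v i (y k)) = 1"
      by (subst sum.swap) (simp add: sum_distrib_left[symmetric] bary_sums assms)
    have "(\<Sum>i\<le>3. (\<Sum>k\<in>K. w k * bary v i (y k)) *\<^sub>R v i)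
        = (\<Sum>k\<in>K. w k *\<^sub>R (\<Sum>i\<le>3. bary v i (y k) *\<^sub>R v i))"
      by (simp only: scaleR_sum_left scaleR_sum_right scaleR_scaleR) (rule sum.swap)
    then show "(\<Sum>i\<le>3. (\<Sum>k\<in>K. w k * bary v i (y k)) *\<^sub>R v i) = (\<Sum>k\<in>K. w k *\<^sub>R y k)"
      by (simp add: bary_sums)
  qed (use assms in simp)
  then show ?thesis by simp
qed

lemma bary_glam:
  assumes "j \<le> 3"
  shows "bary v j x - bary v j y = (x - y) \<bullet> glam j"
proof -
  let ?f = "\<lambda>x. bary v j x - bary v j 0"
  have "bary v j (x + z) = bary v j x + bary v j z - bary v j 0" for x z
    using bary_affine_combination[of "\<lambda>k. if k = 2 then -1 else 1" "{0,1,2::nat}" j "\<lambda>k. if k = 0 then x else if k = 1 then z else 0"]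
      assms by simp
  moreover have "bary v j (r *\<^sub>R x) = r * bary v j x + (1 - r) * bary v j 0" for x r
    using bary_affine_combination[of "\<lambda>k. if k = 0 then r else 1 - r" "{0,1::nat}" j "\<lambda>k. if k = 0 then x else 0"]
      assms by simp
  ultimately have lin: "linear ?f"
    by (intro linearI) (auto simp: algebra_simps)
  define G where "G = adjoint ?f 1"
  have fG: "?f z = z \<bullet> G" for z
    using adjoint_works[OF lin, of z 1] by (simp add: G_def)
  have *: "bary v j z = z \<bullet> G + bary v j 0" for z
    using fG[of z] by simp
  have "GDERIV (bary v j) z :> G" for z
  proof -
    have "((\<lambda>z. z \<bullet> G + bary v j 0) has_derivative (\<lambda>h. h \<bullet> G)) (at z)"
      by (auto intro!: derivative_eq_intros)
    then show ?thesis
      unfolding gderiv_def *[abs_def, symmetric] by (simp add: *[symmetric])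
  qed
  then have "glam j = G"
    unfolding glam_def grad_def
  proof (intro the_equality)
    fix D assume "GDERIV (bary v j) 0 :> D"
    then have "(\<lambda>h. h \<bullet> D) = (\<lambda>h. h \<bullet> G)"
      using \<open>\<And>z. GDERIV (bary v j) z :> G\<close>[of 0] has_derivative_unique unfolding gderiv_def by blast
    then show "D = G" by (rule inner_functional_eqD)
  qed
  then show ?thesis
    using *[of x] *[of y] by (simp add: inner_diff_left)
qed

lemma bary_has_derivative:
  assumes "j \<le> 3"
  shows "(bary v j has_derivative (\<lambda>h. h \<bullet> glam j)) (at x within A)"
proof -
  have eq: "bary v j = (\<lambda>x. x \<bullet> glam j + bary v j 0)"
  proof
    fix x
    show "bary v j x = x \<bullet> glam j + bary v j 0"
      using bary_glam[OF assms, of x 0, unfolded diff_0_right] by linarith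
  qed
  show ?thesis
    by (subst eq) (auto intro!: derivative_eq_intros)
qed

lemma continuous_on_bary: "j \<le> 3 \<Longrightarrow> continuous_on A (bary v j)"
  by (rule has_derivative_continuous_on[OF bary_has_derivative])

lemma bary_vertex: "j \<le> 3 \<Longrightarrow> k \<le> 3 \<Longrightarrow> bary v j (v k) = (if j = k then 1 else 0)"
proof -
  assume jk: "j \<le> 3" "k \<le> 3"
  have "(if i = k then 1 else (0::real)) *\<^sub>R v i = (if i = k then v i else 0)" for i
    by simp
  then show "bary v j (v k) = (if j = k then 1 else 0)"
    using jk by (intro bary_eqI) (simp_all only: sum.delta' sum.delta finite_atMost atMost_iff if_True)
qed

lemma bary_midpoint:
  assumes "j \<le> 3"
  shows "bary v j (midpoint x y) = (bary v j x + bary v j y) / 2"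
  using bary_affine_combination[of "\<lambda>k. 1/2" "{0,1::nat}" j "\<lambda>k. if k = 0 then x else y"] assms
  by (simp add: midpoint_def scaleR_add_right add_divide_distrib)

lemma tet_iff: "x \<in> tet v \<longleftrightarrow> (\<forall>j\<le>3. bary v j x \<ge> 0)"
proof
  assume "x \<in> tet v"
  then obtain u where u: "\<forall>s\<in>v ` {..3}. 0 \<le> u s" "sum u (v ` {..3}) = 1" "(\<Sum>s\<in>v ` {..3}. u s *\<^sub>R s) = x"
    by (auto simp: tet_def convex_hull_finite)
  then have "bary v j x = u (v j)" if "j \<le> 3" for j
    using that by (intro bary_eqI) (simp_all add: sum_over_vertices)
  then show "\<forall>j\<le>3. bary v j x \<ge> 0" using u by auto
next
  assume *: "\<forall>j\<le>3. bary v j x \<ge> 0"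
  have "(\<Sum>k\<le>3. bary v k x *\<^sub>R v k) \<in> tet v"
    unfolding tet_def
    by (rule convex_sum) (use * in \<open>auto simp: bary_sums intro: hull_inc\<close>)
  then show "x \<in> tet v" by (simp add: bary_sums)
qed

lemma interior_tet: "Int_T = {x. \<forall>j\<le>3. bary v j x > 0}"
proof -
  have S: "card (v ` {..3}) = 4"
    by (simp add: card_image[OF inj_v])
  have "Int_T = {y. \<exists>u. (\<forall>x\<in>v ` {..3}. 0 < u x) \<and> sum u (v ` {..3}) = 1 \<and> (\<Sum>x\<in>v ` {..3}. u x *\<^sub>R x) = y}"
    unfolding tet_def using nondeg S
    by (subst interior_convex_hull_explicit_minimal) (auto simp: nondegenerate_def)
  also have "\<dots> = {x. \<forall>j\<le>3. bary v j x > 0}" (is "?L = ?R")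
  proof (intro set_eqI iffI)
    fix x assume "x \<in> ?L"
    then obtain u where u: "\<forall>s\<in>v ` {..3}. 0 < u s" "sum u (v ` {..3}) = 1" "(\<Sum>s\<in>v ` {..3}. u s *\<^sub>R s) = x"
      by auto
    then have "bary v j x = u (v j)" if "j \<le> 3" for j
      using that by (intro bary_eqI) (simp_all add: sum_over_vertices)
    then show "x \<in> ?R" using u by auto
  next
    fix x assume *: "x \<in> ?R"
    define U where "U s = bary v (inv_into {..3} v s) x" for s
    have U: "U (v k) = bary v k x" if "k \<le> 3" for k
      using that by (simp add: U_def inv_into_f_f[OF inj_v])
    show "x \<in> ?L"
      using * by (auto intro!: exI[of _ U] simp: sum_over_vertices U bary_sums)
  qed
  finally show ?thesis .
qed

lemma bary_pos: "x \<in> Int_T \<Longrightarrow> j \<le> 3 \<Longrightarrow> bary v j x > 0"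
  by (simp add: interior_tet)

lemma bary_nonneg: "x \<in> tet v \<Longrightarrow> j \<le> 3 \<Longrightarrow> bary v j x \<ge> 0"
  by (simp add: tet_iff)

lemma vertex_in_tet: "k \<le> 3 \<Longrightarrow> v k \<in> tet v"
  by (simp add: tet_iff bary_vertex)

lemma midpoint_in_tet: "k \<le> 3 \<Longrightarrow> l \<le> 3 \<Longrightarrow> midpoint (v k) (v l) \<in> tet v"
  by (simp add: tet_iff bary_vertex bary_midpoint)

text \<open>Points are constructed below by prescribing their coordinates.\<close>

lemma exists_point_with_bary:
  assumes "(\<Sum>k\<le>3. c k) = 1"
  shows "\<exists>x. \<forall>j\<le>3. bary v j x = c j"
  using bary_eqI[OF assms refl] by blast

lemma Int_T_nonempty: "Int_T \<noteq> {}"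
proof -
  obtain x where x: "\<forall>j\<le>3. bary v j x = 1/4"
    using exists_point_with_bary[of "\<lambda>_. 1/4"] by force
  have "bary v j x > 0" if "j \<le> 3" for j
    using x[rule_format, OF that] by linarith
  then have "x \<in> Int_T" by (simp add: interior_tet)
  then show ?thesis by blast
qed

text \<open>Limits from the interior are unique at every point of the closed tetrahedron, so that
  \<^term>\<open>Lim\<close> in \<^term>\<open>bd_val\<close> and \<^term>\<open>bd_grad\<close> picks the limit whenever one exists.\<close>

lemma at_within_Int_T_nontrivial:
  assumes "p \<in> tet v"
  shows "\<not> trivial_limit (at p within Int_T)"
proof -
  have "closure Int_T = closure (tet v)"
    by (rule convex_closure_interior) (use Int_T_nonempty in \<open>auto simp: tet_def\<close>)
  then have "p \<in> closure Int_T"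
    using assms closure_subset by blast
  moreover have "p islimpt Int_T" if "p \<in> Int_T"
    using that by (simp add: interior_limit_point)
  ultimately show ?thesis
    unfolding trivial_limit_within by (auto simp: closure_def)
qed

lemma glam_diff_vertex:
  assumes "i \<le> 3" "k \<le> 3" "m \<le> 3"
  shows "(v m - v k) \<bullet> glam i = (if i = m then 1 else 0) - (if i = k then 1 else 0)"
  using bary_glam[of i "v m" "v k"] assms by (simp add: bary_vertex)

end

section \<open>Function spaces given by finite families\<close>

lemma restr_add: "restr S (\<lambda>x. f x + g x) = restr S f + restr S g"
  by (auto simp: restr_def fun_eq_iff plus_fun_def)

lemma restr_scale: "restr S (\<lambda>x. c * f x) = c *\<^sub>R restr S f"
  by (auto simp: restr_def fun_eq_iff)

lemma sum_fun_apply: "(\<Sum>i\<in>I. f i) x = (\<Sum>i\<in>I. (f i x :: real))"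
  by (induction I rule: infinite_finite_induct) (auto simp: plus_fun_def zero_fun_def)

lemma restr_sum: "restr S (\<lambda>x. \<Sum>t\<in>I. F t x) = (\<Sum>t\<in>I. restr S (F t))"
  by (auto simp: restr_def fun_eq_iff sum_fun_apply)

lemma span_restr_family:
  assumes "finite I"
  shows "span {restr S (F t) | t. t \<in> I} = {restr S (\<lambda>x. \<Sum>t\<in>I. c t * F t x) | c. True}"
    (is "span ?A = ?B")
proof
  have "subspace ?B"
  proof (rule subspaceI)
    show "0 \<in> ?B"
      by (auto intro!: exI[of _ "\<lambda>_. 0"] simp: restr_def fun_eq_iff zero_fun_def)
  next
    fix f g assume "f \<in> ?B" "g \<in> ?B"
    then obtain c d where "f = restr S (\<lambda>x. \<Sum>t\<in>I. c t * F t x)" "g = restr S (\<lambda>x. \<Sum>t\<in>I. d t * F t x)"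
      by auto
    then have "f + g = restr S (\<lambda>x. \<Sum>t\<in>I. (c t + d t) * F t x)"
      by (simp add: restr_add[symmetric] sum.distrib[symmetric] distrib_right)
    then show "f + g \<in> ?B" by auto
  next
    fix r :: real and f assume "f \<in> ?B"
    then obtain c where "f = restr S (\<lambda>x. \<Sum>t\<in>I. c t * F t x)"
      by auto
    then have "r *\<^sub>R f = restr S (\<lambda>x. \<Sum>t\<in>I. (r * c t) * F t x)"
      by (simp add: restr_scale[symmetric] sum_distrib_left mult.assoc)
    then show "r *\<^sub>R f \<in> ?B" by auto
  qed
  moreover have "?A \<subseteq> ?B"
  proof clarify
    fix t assume "t \<in> I"
    then have "F t = (\<lambda>x. \<Sum>s\<in>I. (if s = t then 1 else 0) * F s x)"
      using assms by (auto simp: fun_eq_iff if_distrib[of "\<lambda>c. c * _"] cong: if_cong)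
    then show "\<exists>c. restr S (F t) = restr S (\<lambda>x. \<Sum>t\<in>I. c t * F t x) \<and> True"
      by metis
  qed
  ultimately show "span ?A \<subseteq> ?B"
    by (rule span_minimal[rotated])
  show "?B \<subseteq> span ?A"
  proof clarify
    fix c :: "'a \<Rightarrow> real"
    have "restr S (\<lambda>x. \<Sum>t\<in>I. c t * F t x) = (\<Sum>t\<in>I. c t *\<^sub>R restr S (F t))"
      by (simp add: restr_sum restr_scale)
    also have "\<dots> \<in> span ?A"
      by (intro span_sum span_scale span_base) auto
    finally show "restr S (\<lambda>x. \<Sum>t\<in>I. c t * F t x) \<in> span ?A" .
  qed
qed

lemma prod_UNIV_3: "prod f (UNIV :: 3 set) = f 1 * f 2 * f 3"
  unfolding UNIV_3 by (simp add: ac_simps)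

lemma monomial_in_polys_on:
  assumes "a + b + c \<le> k"
  shows "restr S (\<lambda>x. x $ 1 ^ a * x $ 2 ^ b * x $ 3 ^ c) \<in> polys_on S k"
proof -
  define e where "e = (\<lambda>i::3. if i = 1 then a else if i = 2 then b else c)"
  have "restr S (\<lambda>x. x $ 1 ^ a * x $ 2 ^ b * x $ 3 ^ c) = restr S (\<lambda>x. \<Prod>j\<in>UNIV. (x $ j) ^ e j)"
    by (simp add: prod_UNIV_3 e_def)
  moreover have "(\<Sum>j\<in>UNIV. e j) \<le> k"
    using assms by (simp add: sum_3 e_def)
  ultimately show ?thesis
    unfolding polys_on_def by (auto intro!: span_base)
qed

definition quad_index :: "(nat \<times> nat) set"
  where "quad_index = {(i, j). i \<le> j \<and> j \<le> 3}"

lemma finite_quad_index: "finite quad_index"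
  by (rule finite_subset[of _ "{..3} \<times> {..3}"]) (auto simp: quad_index_def)

context tetrahedron
begin

definition quad :: "nat \<times> nat \<Rightarrow> real^3 \<Rightarrow> real"
  where "quad t x = bary v (fst t) x * bary v (snd t) x"

lemma quad_in_polys_on:
  assumes ij: "i \<le> 3" "j \<le> 3"
  shows "restr S (\<lambda>x. bary v i x * bary v j x) \<in> polys_on S 2"
proof -
  define m where "m a b c = restr S (\<lambda>x::real^3. x $ 1 ^ a * x $ 2 ^ b * x $ 3 ^ c)" for a b c
  have m: "m a b c \<in> polys_on S 2" if "a + b + c \<le> 2" for a b c
    unfolding m_def using monomial_in_polys_on[OF that] .
  have b: "bary v k x = x $ 1 * glam k $ 1 + x $ 2 * glam k $ 2 + x $ 3 * glam k $ 3 + bary v k 0"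
    if "k \<le> 3" for k x
    using bary_glam[OF that, of x 0] by (simp add: inner_vec_def sum_3)
  define g h c d where "g = glam i" "h = glam j" "c = bary v i 0" "d = bary v j 0"
  have bi: "bary v i x = x $ 1 * g $ 1 + x $ 2 * g $ 2 + x $ 3 * g $ 3 + c"
    and bj: "bary v j x = x $ 1 * h $ 1 + x $ 2 * h $ 2 + x $ 3 * h $ 3 + d" for x
    unfolding g_h_c_d_def by (rule b[OF ij(1)], rule b[OF ij(2)])
  have "restr S (\<lambda>x. bary v i x * bary v j x) =
      (c * d) *\<^sub>R m 0 0 0 + (c * h $ 1 + d * g $ 1) *\<^sub>R m 1 0 0 + (c * h $ 2 + d * g $ 2) *\<^sub>R m 0 1 0
      + (c * h $ 3 + d * g $ 3) *\<^sub>R m 0 0 1 + (g $ 1 * h $ 1) *\<^sub>R m 2 0 0 + (g $ 2 * h $ 2) *\<^sub>R m 0 2 0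
      + (g $ 3 * h $ 3) *\<^sub>R m 0 0 2 + (g $ 1 * h $ 2 + g $ 2 * h $ 1) *\<^sub>R m 1 1 0
      + (g $ 1 * h $ 3 + g $ 3 * h $ 1) *\<^sub>R m 1 0 1 + (g $ 2 * h $ 3 + g $ 3 * h $ 2) *\<^sub>R m 0 1 1"
    unfolding bi bj
    by (auto simp: fun_eq_iff restr_def m_def plus_fun_def power2_eq_square algebra_simps)
  also have "\<dots> \<in> polys_on S 2"
    by (intro subspace_add subspace_scale m) (simp_all add: polys_on_def)
  finally show ?thesis .
qed

text \<open>Multiplying by \<open>\<Sum>\<lambda>\<^sub>k = 1\<close> makes polynomials of degree at most two homogeneous: every affine function
  is a linear form in the barycentric coordinates, so products of two affine functions are
  quadratic forms in them.\<close>

lemma affine_mult_in_span_quad: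
  assumes u: "\<And>x. u x = (\<Sum>k\<le>3. a k * bary v k x)" and w: "\<And>x. w x = (\<Sum>k\<le>3. b k * bary v k x)"
  shows "restr S (\<lambda>x. u x * w x) \<in> span {restr S (quad t) | t. t \<in> quad_index}"
proof -
  let ?Q = "span {restr S (quad t) | t. t \<in> quad_index}"
  have q: "restr S (\<lambda>x. bary v k x * bary v l x) \<in> ?Q" if "k \<le> 3" "l \<le> 3" for k l
  proof (cases "k \<le> l")
    case True
    then have "(k, l) \<in> quad_index" using that by (simp add: quad_index_def)
    then show ?thesis
      by (intro span_base CollectI exI[of _ "(k, l)"]) (simp add: quad_def[abs_def])
  next
    case False
    then have "(l, k) \<in> quad_index" using that by (simp add: quad_index_def)
    then show ?thesis
      by (intro span_base CollectI exI[of _ "(l, k)"]) (simp add: quad_def[abs_def] mult.commute)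
  qed
  have "restr S (\<lambda>x. u x * w x) = (\<Sum>k\<le>3. \<Sum>l\<le>3. (a k * b l) *\<^sub>R restr S (\<lambda>x. bary v k x * bary v l x))"
    by (simp add: u w sum_product restr_sum[symmetric] restr_scale[symmetric] ac_simps)
  also have "\<dots> \<in> ?Q"
    by (intro span_sum span_scale q) auto
  finally show ?thesis .
qed

text \<open>The description of quadratic polynomials used throughout, both on the interior of the tetrahedron
  and on its faces. The set \<open>S\<close> is arbitrary because the homogenization is an identity on the whole
  space.\<close>

lemma polys_on_2:
  "polys_on S 2 = {restr S (\<lambda>x. \<Sum>t\<in>quad_index. c t * quad t x) | c. True}"
proof -
  let ?Q = "span {restr S (quad t) | t. t \<in> quad_index}"
  have "polys_on S 2 = ?Q"
  proof
    have "{restr S (quad t) | t. t \<in> quad_index} \<subseteq> polys_on S 2"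
      using quad_in_polys_on by (auto simp: quad_def[abs_def] quad_index_def)
    then show "?Q \<subseteq> polys_on S 2"
      by (intro span_minimal) (auto simp: polys_on_def)
    have one: "1 = (\<Sum>k\<le>3. 1 * bary v k x)" for x
      by (simp add: bary_sums)
    have coord: "(x::real^3) $ j = (\<Sum>k\<le>3. v k $ j * bary v k x)" for x j
      using arg_cong[OF bary_sums(2)[of x], of "\<lambda>y. y $ j"] by (simp add: mult.commute)
    have prod: "restr S (\<lambda>x. x $ i * x $ j) \<in> ?Q" for i j
      by (rule affine_mult_in_span_quad[OF coord coord])
    have lin: "restr S (\<lambda>x. x $ i) \<in> ?Q" for i
      using affine_mult_in_span_quad[OF one coord, of S i] by simp
    have const: "restr S (\<lambda>x. 1) \<in> ?Q"
      using affine_mult_in_span_quad[OF one one, of S] by simp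
    show "polys_on S 2 \<subseteq> ?Q"
      unfolding polys_on_def
    proof (rule span_minimal)
      show "{restr S (\<lambda>x. \<Prod>j\<in>UNIV. x $ j ^ a j) | a. sum a UNIV \<le> 2} \<subseteq> ?Q"
      proof clarify
        fix a :: "3 \<Rightarrow> nat" assume "sum a UNIV \<le> 2"
        then have "a 1 + a 2 + a 3 \<le> 2" by (simp add: sum_3)
        moreover from this have "a 1 = 0 \<or> a 1 = 1 \<or> a 1 = 2" "a 2 = 0 \<or> a 2 = 1 \<or> a 2 = 2"
          "a 3 = 0 \<or> a 3 = 1 \<or> a 3 = 2"
          by linarith+
        ultimately have "(a 1, a 2, a 3) \<in> {(0,0,0),(1,0,0),(0,1,0),(0,0,1),(2,0,0),(0,2,0),(0,0,2),(1,1,0),(1,0,1),(0,1,1)}"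
          by (elim disjE) simp_all
        then show "restr S (\<lambda>x. \<Prod>j\<in>UNIV. x $ j ^ a j) \<in> ?Q"
          using prod lin const by (auto simp: prod_UNIV_3 power2_eq_square)
      qed
    qed simp
  qed
  then show ?thesis
    by (rule trans[OF _ span_restr_family[OF finite_quad_index]])
qed

end

section \<open>Boundary jets\<close>

text \<open>At a zero of the denominator the quotient has the value \<open>0\<close>, which is also its limit as soon as the
  numerator is smaller than the denominator by a factor \<open>h\<close> that tends to zero.\<close>

lemma continuous_on_dominated_quotient:
  fixes f D h :: "'a::metric_space \<Rightarrow> real"
  assumes f: "continuous_on S f" and D: "continuous_on S D" and h: "continuous_on S h"
    and dom: "\<And>x. x \<in> S \<Longrightarrow> \<bar>f x\<bar> \<le> \<bar>D x\<bar> * h x"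
    and zero: "\<And>x. x \<in> S \<Longrightarrow> D x = 0 \<Longrightarrow> h x = 0"
    and nonneg: "\<And>x. x \<in> S \<Longrightarrow> 0 \<le> h x"
  shows "continuous_on S (\<lambda>x. f x / D x)"
  unfolding continuous_on
proof
  fix p assume p: "p \<in> S"
  show "((\<lambda>x. f x / D x) \<longlongrightarrow> f p / D p) (at p within S)"
  proof (cases "D p = 0")
    case False
    then show ?thesis
      using f D p unfolding continuous_on by (intro tendsto_divide) auto
  next
    case True
    have bound: "\<bar>f x / D x\<bar> \<le> h x" if "x \<in> S" for x
      using dom[OF that] nonneg[OF that]
      by (cases "D x = 0") (simp_all add: abs_divide pos_divide_le_eq mult.commute)
    have "(h \<longlongrightarrow> 0) (at p within S)"
      using h p zero[OF p True] unfolding continuous_on by metis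
    then have "((\<lambda>x. f x / D x) \<longlongrightarrow> 0) (at p within S)"
      by (rule Lim_null_comparison[rotated]) (use bound in \<open>simp add: eventually_at_filter\<close>)
    then show ?thesis using True by simp
  qed
qed

text \<open>The three partial derivatives of the bubble \<open>a b\<^sup>2 c\<^sup>2 / ((a + b)(a + c))\<close>; the last two are
  \<^term>\<open>Phi\<close> at an end of the edge, and the first is \<^term>\<open>Phi\<close> at the opposite vertex plus \<open>b c\<close>.\<close>

lemma edge_bubble_partials:
  fixes a b c :: real
  assumes "a > 0" "b > 0" "c > 0"
    and A: "(fa has_derivative da) (at x)" and B: "(fb has_derivative db) (at x)"
    and C: "(fc has_derivative dc) (at x)" and eq: "fa x = a" "fb x = b" "fc x = c"
  shows "((\<lambda>x. fa x * (fb x)\<^sup>2 * (fc x)\<^sup>2 / ((fa x + fb x) * (fa x + fc x))) has_derivative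
     (\<lambda>h. da h * (b\<^sup>2 * c\<^sup>2 * (b * c - a\<^sup>2) / ((a + b)\<^sup>2 * (a + c)\<^sup>2))
        + db h * (a * b * c\<^sup>2 * (2 * a + b) / ((a + b)\<^sup>2 * (a + c)))
        + dc h * (a * b\<^sup>2 * c * (2 * a + c) / ((a + b) * (a + c)\<^sup>2)))) (at x)"
proof -
  have ne: "fa x + fb x \<noteq> 0" "fa x + fc x \<noteq> 0"
    using assms(1-3) by (simp_all add: eq)
  \<comment> \<open>Eliminating \<open>b\<close> and \<open>c\<close> in favour of the denominators makes the final identity a polynomial one.\<close>
  define r s where "r = a + b" and "s = a + c"
  have rs: "r \<noteq> 0" "s \<noteq> 0" "a + b = r" "a + c = s" "b = r - a" "c = s - a"
    using assms(1-3) by (simp_all add: r_def s_def)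
  have P: "((\<lambda>x. (fb x)\<^sup>2 / (fa x + fb x)) has_derivative
      (\<lambda>h. (b * (2 * a + b) * db h - b\<^sup>2 * da h) / (a + b)\<^sup>2)) (at x)"
    by (rule derivative_eq_intros A B ne refl)+
       (use ne in \<open>simp add: eq fun_eq_iff field_simps power2_eq_square\<close>)
  have Q: "((\<lambda>x. (fc x)\<^sup>2 / (fa x + fc x)) has_derivative
      (\<lambda>h. (c * (2 * a + c) * dc h - c\<^sup>2 * da h) / (a + c)\<^sup>2)) (at x)"
    by (rule derivative_eq_intros A C ne refl)+
       (use ne in \<open>simp add: eq fun_eq_iff field_simps power2_eq_square\<close>)
  have "((\<lambda>x. fa x * ((fb x)\<^sup>2 / (fa x + fb x)) * ((fc x)\<^sup>2 / (fa x + fc x))) has_derivative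
     (\<lambda>h. da h * (b\<^sup>2 * c\<^sup>2 * (b * c - a\<^sup>2) / ((a + b)\<^sup>2 * (a + c)\<^sup>2))
        + db h * (a * b * c\<^sup>2 * (2 * a + b) / ((a + b)\<^sup>2 * (a + c)))
        + dc h * (a * b\<^sup>2 * c * (2 * a + c) / ((a + b) * (a + c)\<^sup>2)))) (at x)"
    by (rule derivative_eq_intros A P Q refl)+
      (use rs(1,2) in \<open>simp add: eq rs(3,4) fun_eq_iff, simp add: rs(5,6) divide_simps, simp add: algebra_simps power2_eq_square\<close>)
  then show ?thesis by simp
qed

context tetrahedron
begin

text \<open>The continuous extension of \<open>f\<close> and of its gradient to \<open>p\<close>. Treating both limits together gives one
  calculus of linear combinations from which the values of \<^term>\<open>bd_val\<close> and \<^term>\<open>bd_grad\<close> are read off.\<close>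

definition has_bd_jet :: "(real^3 \<Rightarrow> real) \<Rightarrow> real^3 \<Rightarrow> real \<Rightarrow> real^3 \<Rightarrow> bool"
  where "has_bd_jet f p u U \<longleftrightarrow> (f \<longlongrightarrow> u) (at p within Int_T) \<and>
    (\<exists>G. (\<forall>x\<in>Int_T. GDERIV f x :> G x) \<and> (G \<longlongrightarrow> U) (at p within Int_T))"

lemma has_bd_jet_cong:
  assumes "\<And>x. x \<in> Int_T \<Longrightarrow> f x = g x"
  shows "has_bd_jet f p u U \<longleftrightarrow> has_bd_jet g p u U"
proof -
  have *: "has_bd_jet g p u U" if "has_bd_jet f p u U" and eq: "\<And>x. x \<in> Int_T \<Longrightarrow> f x = g x" for f g
  proof -
    from that obtain G where G: "\<forall>x\<in>Int_T. GDERIV f x :> G x" "(G \<longlongrightarrow> U) (at p within Int_T)"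
      and f: "(f \<longlongrightarrow> u) (at p within Int_T)"
      by (auto simp: has_bd_jet_def)
    have "GDERIV g x :> G x" if x: "x \<in> Int_T" for x
      unfolding gderiv_def
      by (rule has_derivative_transform_within_open[OF _ open_interior x eq])
         (use G(1) x in \<open>auto simp: gderiv_def\<close>)
    moreover have "(g \<longlongrightarrow> u) (at p within Int_T)"
      by (rule Lim_transform_eventually[OF f]) (simp add: eventually_at_filter eq)
    ultimately show ?thesis
      using G(2) by (auto simp: has_bd_jet_def)
  qed
  show ?thesis
    using *[of f g] *[of g f] assms by auto
qed

lemma has_bd_jet_restr: "has_bd_jet (restr Int_T f) p u U \<longleftrightarrow> has_bd_jet f p u U"
  by (rule has_bd_jet_cong) (simp add: restr_def)

lemma has_bd_jet_zero: "has_bd_jet (\<lambda>x. 0) p 0 0"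
  unfolding has_bd_jet_def using GDERIV_const by (auto intro!: exI[of _ "\<lambda>x. 0"])

lemma has_bd_jet_add:
  assumes "has_bd_jet f p u U" "has_bd_jet g p w W"
  shows "has_bd_jet (\<lambda>x. f x + g x) p (u + w) (U + W)"
proof -
  obtain F G where "\<forall>x\<in>Int_T. GDERIV f x :> F x" "(F \<longlongrightarrow> U) (at p within Int_T)"
     "\<forall>x\<in>Int_T. GDERIV g x :> G x" "(G \<longlongrightarrow> W) (at p within Int_T)"
    using assms by (auto simp: has_bd_jet_def)
  then show ?thesis
    using assms unfolding has_bd_jet_def
    by (auto intro!: tendsto_intros exI[of _ "\<lambda>x. F x + G x"] simp: GDERIV_add)
qed

lemma has_bd_jet_scale:
  assumes "has_bd_jet f p u U"
  shows "has_bd_jet (\<lambda>x. c * f x) p (c * u) (c *\<^sub>R U)"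
proof -
  obtain F where F: "\<forall>x\<in>Int_T. GDERIV f x :> F x" "(F \<longlongrightarrow> U) (at p within Int_T)"
    using assms by (auto simp: has_bd_jet_def)
  have "GDERIV (\<lambda>x. c * f x) x :> c *\<^sub>R F x" if "x \<in> Int_T" for x
    using GDERIV_mult[OF GDERIV_const] F(1) that by fastforce
  then show ?thesis
    using assms F unfolding has_bd_jet_def
    by (auto intro!: tendsto_intros exI[of _ "\<lambda>x. c *\<^sub>R F x"])
qed

lemma has_bd_jet_sum:
  assumes "\<And>t. t \<in> I \<Longrightarrow> has_bd_jet (f t) p (u t) (U t)"
  shows "has_bd_jet (\<lambda>x. \<Sum>t\<in>I. f t x) p (\<Sum>t\<in>I. u t) (\<Sum>t\<in>I. U t)"
  using assms
  by (induction I rule: infinite_finite_induct) (auto simp: has_bd_jet_zero has_bd_jet_add)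

lemma has_bd_jet_linear_combination:
  assumes "\<And>t. t \<in> I \<Longrightarrow> has_bd_jet (f t) p (u t) (U t)"
  shows "has_bd_jet (\<lambda>x. \<Sum>t\<in>I. c t * f t x) p (\<Sum>t\<in>I. c t * u t) (\<Sum>t\<in>I. c t *\<^sub>R U t)"
  using assms by (intro has_bd_jet_sum has_bd_jet_scale)

lemma bd_val_eq:
  assumes "has_bd_jet f p u U" "p \<in> tet v"
  shows "bd_val v f p = u"
  unfolding bd_val_def using assms
  by (intro tendsto_Lim at_within_Int_T_nontrivial) (auto simp: has_bd_jet_def)

lemma bd_grad_eq:
  assumes "has_bd_jet f p u U" "p \<in> tet v"
  shows "bd_grad v f p = U"
proof -
  obtain G where G: "\<forall>x\<in>Int_T. GDERIV f x :> G x" "(G \<longlongrightarrow> U) (at p within Int_T)"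
    using assms by (auto simp: has_bd_jet_def)
  have "grad f x = G x" if "x \<in> Int_T" for x
    unfolding grad_def
  proof (rule the_equality)
    show *: "GDERIV f x :> G x" using G that by simp
    fix D assume "GDERIV f x :> D"
    then have "(\<lambda>h. h \<bullet> D) = (\<lambda>h. h \<bullet> G x)"
      using * has_derivative_unique unfolding gderiv_def by blast
    then show "D = G x" by (rule inner_functional_eqD)
  qed
  then have "(grad f \<longlongrightarrow> U) (at p within Int_T)"
    by (intro Lim_transform_eventually[OF G(2)]) (simp add: eventually_at_filter)
  then show ?thesis
    unfolding bd_grad_def using assms by (intro tendsto_Lim at_within_Int_T_nontrivial)
qed

lemma has_bd_jet_continuous:
  assumes "continuous_on (tet v) f" "continuous_on (tet v) G" "\<And>x. x \<in> Int_T \<Longrightarrow> GDERIV f x :> G x"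
    "p \<in> tet v"
  shows "has_bd_jet f p (f p) (G p)"
  unfolding has_bd_jet_def using assms
  by (meson continuous_on interior_subset tendsto_within_subset)

lemma has_bd_jet_quad:
  assumes "p \<in> tet v" "i \<le> 3" "j \<le> 3"
  shows "has_bd_jet (quad (i, j)) p (quad (i, j) p) (bary v i p *\<^sub>R glam j + bary v j p *\<^sub>R glam i)"
proof (rule has_bd_jet_continuous[where G = "\<lambda>p. bary v i p *\<^sub>R glam j + bary v j p *\<^sub>R glam i"])
  fix x
  show "GDERIV (quad (i, j)) x :> bary v i x *\<^sub>R glam j + bary v j x *\<^sub>R glam i"
    using assms unfolding quad_def fst_conv snd_conv
    by (intro GDERIV_mult) (auto simp: gderiv_def bary_has_derivative)
qed (use assms in \<open>auto simp: quad_def intro!: continuous_intros continuous_on_bary\<close>)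

definition skew_cubic :: "nat \<times> nat \<Rightarrow> real^3 \<Rightarrow> real"
  where "skew_cubic t x = (bary v (fst t) x)\<^sup>2 * bary v (snd t) x - (bary v (snd t) x)\<^sup>2 * bary v (fst t) x"

lemma has_bd_jet_skew_cubic:
  assumes "p \<in> tet v" "i \<le> 3" "j \<le> 3"
  shows "has_bd_jet (skew_cubic (i, j)) p (skew_cubic (i, j) p)
    ((2 * bary v i p * bary v j p - (bary v j p)\<^sup>2) *\<^sub>R glam i
      + ((bary v i p)\<^sup>2 - 2 * bary v i p * bary v j p) *\<^sub>R glam j)"
proof (rule has_bd_jet_continuous[where G = "\<lambda>p. (2 * bary v i p * bary v j p - (bary v j p)\<^sup>2) *\<^sub>R glam i
      + ((bary v i p)\<^sup>2 - 2 * bary v i p * bary v j p) *\<^sub>R glam j"])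
  fix x
  show "GDERIV (skew_cubic (i, j)) x :> (2 * bary v i x * bary v j x - (bary v j x)\<^sup>2) *\<^sub>R glam i
      + ((bary v i x)\<^sup>2 - 2 * bary v i x * bary v j x) *\<^sub>R glam j"
    unfolding skew_cubic_def gderiv_def fst_conv snd_conv
    by (auto intro!: derivative_eq_intros bary_has_derivative assms
        simp: fun_eq_iff algebra_simps inner_add_right power2_eq_square)
qed (use assms in \<open>auto simp: skew_cubic_def intro!: continuous_intros continuous_on_bary\<close>)

definition bubble :: "nat \<times> nat \<times> nat \<Rightarrow> real^3 \<Rightarrow> real"
  where "bubble t = (case t of (l, m, n) \<Rightarrow> edge_bubble v l m n)"

definition bubble_grad :: "nat \<times> nat \<times> nat \<Rightarrow> real^3 \<Rightarrow> real^3"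
  where "bubble_grad t x = (case t of (l, m, n) \<Rightarrow>
     (Phi (l, m, n, n) (\<lambda>j. bary v j x) + bary v l x * bary v m x) *\<^sub>R glam n
     + Phi (l, m, n, l) (\<lambda>j. bary v j x) *\<^sub>R glam l + Phi (l, m, n, m) (\<lambda>j. bary v j x) *\<^sub>R glam m)"

text \<open>The bubbles are continuously differentiable up to the boundary, although their denominators vanish
  on edges: each numerator is dominated by its denominator times a factor that vanishes where
  the denominator does.\<close>

lemma has_bd_jet_bubble:
  assumes "p \<in> tet v" and ind: "l \<le> 3" "m \<le> 3" "n \<le> 3" "l \<noteq> m" "n \<noteq> l" "n \<noteq> m"
  shows "has_bd_jet (bubble (l, m, n)) p (bubble (l, m, n) p) (bubble_grad (l, m, n) p)"
proof (rule has_bd_jet_continuous)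
  let ?a = "bary v n" and ?b = "bary v l" and ?c = "bary v m"
  note cont = continuous_on_bary[OF \<open>l \<le> 3\<close>] continuous_on_bary[OF \<open>m \<le> 3\<close>] continuous_on_bary[OF \<open>n \<le> 3\<close>]
  have nonneg: "?a x \<ge> 0" "?b x \<ge> 0" "?c x \<ge> 0" if "x \<in> tet v" for x
    using that ind by (simp_all add: bary_nonneg)
  fix x assume "x \<in> Int_T"
  then have pos: "?a x > 0" "?b x > 0" "?c x > 0"
    using ind by (simp_all add: bary_pos)
  show "GDERIV (bubble (l, m, n)) x :> bubble_grad (l, m, n) x"
    unfolding bubble_def case_prod_conv gderiv_def edge_bubble_def
    by (rule has_derivative_eq_rhs, rule edge_bubble_partials[OF pos bary_has_derivative[OF \<open>n \<le> 3\<close>]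
          bary_has_derivative[OF \<open>l \<le> 3\<close>] bary_has_derivative[OF \<open>m \<le> 3\<close>] refl refl refl])
      (use ind in \<open>auto simp: bubble_grad_def fun_eq_iff inner_add_right mult_ac\<close>)
next
  let ?a = "bary v n" and ?b = "bary v l" and ?c = "bary v m"
  note cont = continuous_on_bary[OF \<open>l \<le> 3\<close>] continuous_on_bary[OF \<open>m \<le> 3\<close>] continuous_on_bary[OF \<open>n \<le> 3\<close>]
  have nonneg: "?a x \<ge> 0" "?b x \<ge> 0" "?c x \<ge> 0" if "x \<in> tet v" for x
    using that ind by (simp_all add: bary_nonneg)
  have sq: "b\<^sup>2 \<le> (a + b)\<^sup>2" if "0 \<le> a" "0 \<le> b" for a b :: real
    using that by (intro power_mono) auto
  show "continuous_on (tet v) (bubble (l, m, n))"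
    unfolding bubble_def case_prod_conv edge_bubble_def
  proof (rule continuous_on_dominated_quotient[where h = "\<lambda>x. ?a x * ?b x * ?c x"])
    fix x assume x: "x \<in> tet v"
    note nn = nonneg[OF x]
    have "?b x * ?c x \<le> (?a x + ?b x) * (?a x + ?c x)"
      using nn by (intro mult_mono) auto
    then have "(?b x * ?c x) * (?a x * ?b x * ?c x) \<le> (?a x + ?b x) * (?a x + ?c x) * (?a x * ?b x * ?c x)"
      using nn by (intro mult_right_mono) auto
    then show "\<bar>?a x * (?b x)\<^sup>2 * (?c x)\<^sup>2\<bar> \<le> \<bar>(?a x + ?b x) * (?a x + ?c x)\<bar> * (?a x * ?b x * ?c x)"
      using nn by (simp add: abs_mult power2_eq_square ac_simps)
    show "?a x * ?b x * ?c x = 0" if "(?a x + ?b x) * (?a x + ?c x) = 0"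
      using that nn by (auto simp: add_nonneg_eq_0_iff)
    show "0 \<le> ?a x * ?b x * ?c x" using nn by simp
  qed (intro continuous_intros cont)+
  have "continuous_on (tet v) (\<lambda>x. (?b x)\<^sup>2 * (?c x)\<^sup>2 * (?b x * ?c x - (?a x)\<^sup>2) / ((?a x + ?b x)\<^sup>2 * (?a x + ?c x)\<^sup>2))"
  proof (rule continuous_on_dominated_quotient[where h = "\<lambda>x. ?b x * ?c x + (?a x)\<^sup>2"])
    fix x assume x: "x \<in> tet v"
    note nn = nonneg[OF x]
    have "\<bar>?b x * ?c x - (?a x)\<^sup>2\<bar> \<le> ?b x * ?c x + (?a x)\<^sup>2"
      using abs_triangle_ineq4[of "?b x * ?c x" "(?a x)\<^sup>2"] nn by simp
    then have "\<bar>(?b x)\<^sup>2 * (?c x)\<^sup>2\<bar> * \<bar>?b x * ?c x - (?a x)\<^sup>2\<bar> \<le> ((?a x + ?b x)\<^sup>2 * (?a x + ?c x)\<^sup>2) * (?b x * ?c x + (?a x)\<^sup>2)"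
      using nn by (intro mult_mono) (auto simp: abs_mult intro!: mult_mono sq)
    then show "\<bar>(?b x)\<^sup>2 * (?c x)\<^sup>2 * (?b x * ?c x - (?a x)\<^sup>2)\<bar>
        \<le> \<bar>(?a x + ?b x)\<^sup>2 * (?a x + ?c x)\<^sup>2\<bar> * (?b x * ?c x + (?a x)\<^sup>2)"
      by (simp add: abs_mult)
    show "?b x * ?c x + (?a x)\<^sup>2 = 0" if "(?a x + ?b x)\<^sup>2 * (?a x + ?c x)\<^sup>2 = 0"
      using that nn by (auto simp: add_nonneg_eq_0_iff)
    show "0 \<le> ?b x * ?c x + (?a x)\<^sup>2" using nn by simp
  qed (intro continuous_intros cont)+
  moreover have mixed: "continuous_on (tet v) (\<lambda>x. ?a x * B x * (C x)\<^sup>2 * (2 * ?a x + B x) / ((?a x + B x)\<^sup>2 * (?a x + C x)))"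
    if B: "continuous_on (tet v) B" "continuous_on (tet v) C" "\<And>x. x \<in> tet v \<Longrightarrow> B x \<ge> 0 \<and> C x \<ge> 0" for B C
  proof (rule continuous_on_dominated_quotient[where h = "\<lambda>x. ?a x * C x"])
    fix x assume x: "x \<in> tet v"
    have nn: "?a x \<ge> 0" "B x \<ge> 0" "C x \<ge> 0" using nonneg[OF x] B(3)[OF x] by auto
    have "(B x * (2 * ?a x + B x)) * C x * (?a x * C x) \<le> (?a x + B x)\<^sup>2 * (?a x + C x) * (?a x * C x)"
      using nn by (intro mult_mono) (auto simp: power2_eq_square algebra_simps)
    then show "\<bar>?a x * B x * (C x)\<^sup>2 * (2 * ?a x + B x)\<bar> \<le> \<bar>(?a x + B x)\<^sup>2 * (?a x + C x)\<bar> * (?a x * C x)"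
      using nn by (simp add: abs_mult power2_eq_square ac_simps)
    show "?a x * C x = 0" if "(?a x + B x)\<^sup>2 * (?a x + C x) = 0"
      using that nn by (auto simp: add_nonneg_eq_0_iff)
    show "0 \<le> ?a x * C x" using nn by simp
  qed (intro continuous_intros cont B)+
  have "continuous_on (tet v) (\<lambda>x. ?a x * ?b x * (?c x)\<^sup>2 * (2 * ?a x + ?b x) / ((?a x + ?b x)\<^sup>2 * (?a x + ?c x)))"
    by (rule mixed) (use cont nonneg in auto)
  moreover have "continuous_on (tet v) (\<lambda>x. ?a x * (?b x)\<^sup>2 * ?c x * (2 * ?a x + ?c x) / ((?a x + ?b x) * (?a x + ?c x)\<^sup>2))"
    using mixed[of ?c ?b] cont nonneg by (simp add: mult_ac)
  ultimately show "continuous_on (tet v) (bubble_grad (l, m, n))"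
    using ind by (auto simp: bubble_grad_def intro!: continuous_intros)
qed (fact assms(1))

end

section \<open>The edge-enriched space\<close>

definition cubic_index :: "(nat \<times> nat) set"
  where "cubic_index = {(i, j). i < j \<and> j \<le> 3}"

definition bubble_index :: "(nat \<times> nat \<times> nat) set"
  where "bubble_index = {(l, m, n). l < m \<and> m \<le> 3 \<and> n \<in> {..3} - {l, m}}"

lemma finite_cubic_index: "finite cubic_index"
  by (rule finite_subset[of _ "{..3} \<times> {..3}"]) (auto simp: cubic_index_def)

lemma finite_bubble_index: "finite bubble_index"
  by (rule finite_subset[of _ "{..3} \<times> {..3} \<times> {..3}"]) (auto simp: bubble_index_def)

lemma finite_face_index: "finite (face_index i)"
  by (rule finite_subset[of _ "{..3} \<times> {..3} \<times> {..3} \<times> {..3}"]) (auto simp: face_index_def)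

lemma exists_fourth_index: "\<exists>l\<le>3. l \<noteq> i \<and> l \<noteq> j \<and> l \<noteq> (k::nat)"
proof -
  have "\<not> {..3} \<subseteq> {i, j, k}"
  proof
    assume "{..3} \<subseteq> {i, j, k}"
    then have "card {..3::nat} \<le> card {i, j, k}" by (intro card_mono) auto
    also have "\<dots> \<le> 3" by (simp add: card_insert_if)
    finally show False by simp
  qed
  then show ?thesis by auto
qed

text \<open>All \<^term>\<open>Phi\<close> vanish on the boundary of the face; for the vertex opposite to the edge this is the
  cancellation of \<open>\<mu>\<^sub>l \<mu>\<^sub>m\<close> against the quotient at \<open>\<mu>\<^sub>n = 0\<close>.\<close>

lemma Phi_eq_0:
  assumes "\<mu> l = 0 \<or> \<mu> m = 0 \<or> \<mu> n = 0"
  shows "Phi (l, m, n, k) \<mu> = 0"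
  using assms by (cases "\<mu> l = 0"; cases "\<mu> m = 0") (auto simp: power2_eq_square)

lemma Phi_cong:
  assumes "\<mu> l = \<mu>' l" "\<mu> m = \<mu>' m" "\<mu> n = \<mu>' n"
  shows "Phi (l, m, n, k) \<mu> = Phi (l, m, n, k) \<mu>'"
  using assms by simp

lemma Phi_homogeneous:
  assumes "s \<noteq> 0"
  shows "Phi t (\<lambda>j. s * \<mu> j) = s\<^sup>2 * Phi t \<mu>"
proof -
  obtain l m n k where t: "t = (l, m, n, k)" by (cases t)
  have D: "s * \<mu> i + s * \<mu> j = s * (\<mu> i + \<mu> j)" for i j by (simp add: distrib_left)
  have q2: "(s ^ 5 * N) / (s ^ 3 * D) = s\<^sup>2 * (N / D)" for N D :: real
    using assms by (simp add: eval_nat_numeral)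
  have q3: "(s ^ 6 * N) / (s ^ 4 * D) = s\<^sup>2 * (N / D)" for N D :: real
    using assms by (simp add: eval_nat_numeral)
  have 1: "s * a * (s * b) * (s * c)\<^sup>2 * (2 * (s * a) + s * b) / ((s * a + s * b)\<^sup>2 * (s * a + s * c))
      = s\<^sup>2 * (a * b * c\<^sup>2 * (2 * a + b) / ((a + b)\<^sup>2 * (a + c)))" for a b c
    unfolding q2[symmetric] by (rule arg_cong2[of _ _ _ _ "(/)"]) (algebra+)
  have 2: "s * a * (s * b)\<^sup>2 * (s * c) * (2 * (s * a) + s * c) / ((s * a + s * b) * (s * a + s * c)\<^sup>2)
      = s\<^sup>2 * (a * b\<^sup>2 * c * (2 * a + c) / ((a + b) * (a + c)\<^sup>2))" for a b c
    unfolding q2[symmetric] by (rule arg_cong2[of _ _ _ _ "(/)"]) (algebra+)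
  have 3: "(s * b)\<^sup>2 * (s * c)\<^sup>2 * ((s * b) * (s * c) - (s * a)\<^sup>2) / ((s * a + s * b)\<^sup>2 * (s * a + s * c)\<^sup>2)
      = s\<^sup>2 * (b\<^sup>2 * c\<^sup>2 * (b * c - a\<^sup>2) / ((a + b)\<^sup>2 * (a + c)\<^sup>2))" for a b c
    unfolding q3[symmetric] by (rule arg_cong2[of _ _ _ _ "(/)"]) (algebra+)
  have 4: "s\<^sup>2 * X - (s * b) * (s * c) = s\<^sup>2 * (X - b * c)" for X b c
    by (simp add: power2_eq_square right_diff_distrib)
  show ?thesis
    unfolding t Phi.simps 1 2 3 4 by (simp only: if_distrib[of "\<lambda>X. s\<^sup>2 * X"])
qed

context tetrahedron
begin

definition quad_grad :: "nat \<times> nat \<Rightarrow> real^3 \<Rightarrow> real^3"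
  where "quad_grad t x = bary v (fst t) x *\<^sub>R glam (snd t) + bary v (snd t) x *\<^sub>R glam (fst t)"

definition cubic_grad :: "nat \<times> nat \<Rightarrow> real^3 \<Rightarrow> real^3"
  where "cubic_grad t x = (case t of (i, j) \<Rightarrow>
    (2 * bary v i x * bary v j x - (bary v j x)\<^sup>2) *\<^sub>R glam i
      + ((bary v i x)\<^sup>2 - 2 * bary v i x * bary v j x) *\<^sub>R glam j)"

text \<open>The general element of \<open>Z3e\<close>, as a formula that makes sense on the closed tetrahedron; at boundary
  points it gives the continuous extension, and so does the formula for its gradient.\<close>

definition enriched where
  "enriched \<alpha> \<beta> \<kappa> x = (\<Sum>t\<in>quad_index. \<alpha> t * quad t x) + (\<Sum>t\<in>cubic_index. \<beta> t * skew_cubic t x)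
    + (\<Sum>t\<in>bubble_index. \<kappa> t * bubble t x)"

definition enriched_grad where
  "enriched_grad \<alpha> \<beta> \<kappa> x = (\<Sum>t\<in>quad_index. \<alpha> t *\<^sub>R quad_grad t x) + (\<Sum>t\<in>cubic_index. \<beta> t *\<^sub>R cubic_grad t x)
    + (\<Sum>t\<in>bubble_index. \<kappa> t *\<^sub>R bubble_grad t x)"

lemma has_bd_jet_enriched:
  assumes "p \<in> tet v"
  shows "has_bd_jet (restr Int_T (enriched \<alpha> \<beta> \<kappa>)) p (enriched \<alpha> \<beta> \<kappa> p) (enriched_grad \<alpha> \<beta> \<kappa> p)"
proof -
  have "has_bd_jet (quad t) p (quad t p) (quad_grad t p)" if "t \<in> quad_index" for t
    using has_bd_jet_quad[OF assms, of "fst t" "snd t"] that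
    by (auto simp: quad_grad_def quad_index_def)
  moreover have "has_bd_jet (skew_cubic t) p (skew_cubic t p) (cubic_grad t p)" if "t \<in> cubic_index" for t
    using has_bd_jet_skew_cubic[OF assms, of "fst t" "snd t"] that
    by (auto simp: cubic_grad_def cubic_index_def)
  moreover have "has_bd_jet (bubble t) p (bubble t p) (bubble_grad t p)" if "t \<in> bubble_index" for t
    using has_bd_jet_bubble[OF assms] that by (auto simp: bubble_index_def)
  ultimately have "has_bd_jet (\<lambda>x. enriched \<alpha> \<beta> \<kappa> x) p (enriched \<alpha> \<beta> \<kappa> p) (enriched_grad \<alpha> \<beta> \<kappa> p)"
    unfolding enriched_def enriched_grad_def
    by (intro has_bd_jet_add has_bd_jet_linear_combination)
  then show ?thesis by (simp add: has_bd_jet_restr)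
qed

lemma Z3e_sum:
  "Z3e v = {z + b | z b. z \<in> {p + c | p c. p \<in> polys_on Int_T 2 \<and> c \<in> span {restr Int_T (skew_cubic t) | t. t \<in> cubic_index}}
      \<and> b \<in> span {restr Int_T (bubble t) | t. t \<in> bubble_index}}"
proof -
  have "{restr Int_T (\<lambda>x. (bary v i x)\<^sup>2 * bary v j x - (bary v j x)\<^sup>2 * bary v i x) | i j. i < j \<and> j \<le> 3}
      = {restr Int_T (skew_cubic t) | t. t \<in> cubic_index}"
    by (auto simp: skew_cubic_def[abs_def] cubic_index_def)
  moreover have "{restr Int_T (edge_bubble v l m n) | l m n. l < m \<and> m \<le> 3 \<and> n \<in> {..3} - {l, m}}
      = {restr Int_T (bubble t) | t. t \<in> bubble_index}"
    unfolding bubble_def bubble_index_def by fastforce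
  ultimately show ?thesis
    unfolding Z3e_def Z30_def by simp
qed

lemma Z3e_eq: "Z3e v = {restr Int_T (enriched \<alpha> \<beta> \<kappa>) | \<alpha> \<beta> \<kappa>. True}"
  unfolding Z3e_sum polys_on_2 span_restr_family[OF finite_cubic_index] span_restr_family[OF finite_bubble_index]
    enriched_def[abs_def] restr_add
  by blast

lemma subspace_Z3e: "subspace (Z3e v)"
  unfolding Z3e_sum by (intro subspace_sums) (simp_all add: polys_on_def)

lemma Z3e_jet:
  assumes "z \<in> Z3e v" "p \<in> tet v"
  shows "has_bd_jet z p (bd_val v z p) (bd_grad v z p)"
proof -
  obtain \<alpha> \<beta> \<kappa> where z: "z = restr Int_T (enriched \<alpha> \<beta> \<kappa>)"
    using assms(1) by (auto simp: Z3e_eq)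
  show ?thesis
    using has_bd_jet_enriched[OF assms(2), of \<alpha> \<beta> \<kappa>] bd_val_eq[OF _ assms(2)] bd_grad_eq[OF _ assms(2)]
    unfolding z by metis
qed

section \<open>The face decomposition\<close>

lemma face_subset_tet: "face v i \<subseteq> tet v"
  by (auto simp: face_def)

lemma subspace_polys_on: "subspace (polys_on S k)"
  by (simp add: polys_on_def)

lemma subspace_Q_edge: "subspace (Q_edge v i)"
  by (simp add: Q_edge_def)

lemma Q_edge_eq: "Q_edge v i = {restr (face v i) (Phi_sum v i c) | c. True}"
  unfolding Q_edge_def Phi_sum_def[abs_def] by (rule span_restr_family[OF finite_face_index])

lemma bary_in_polys_on:
  assumes "i \<le> 3"
  shows "restr S (bary v i) \<in> polys_on S 2"
proof -
  have "restr S (bary v i) = restr S (\<lambda>x. \<Sum>k\<le>3. bary v i x * bary v k x)"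
    by (simp add: sum_distrib_left[symmetric] bary_sums)
  also have "\<dots> \<in> polys_on S 2"
    unfolding restr_sum by (intro subspace_sum subspace_polys_on quad_in_polys_on assms) simp
  finally show ?thesis .
qed

text \<open>The functions on the face that have a quadratic part and an edge part, as the normal derivatives
  should.\<close>

definition face_traces :: "nat \<Rightarrow> (real^3 \<Rightarrow> real) set"
  where "face_traces i = {p + q | p q. p \<in> polys_on (face v i) 2 \<and> q \<in> Q_edge v i}"

lemma subspace_face_traces: "subspace (face_traces i)"
  unfolding face_traces_def by (intro subspace_sums subspace_polys_on subspace_Q_edge)

lemma poly_in_face_traces: "p \<in> polys_on (face v i) 2 \<Longrightarrow> p \<in> face_traces i"
  unfolding face_traces_def using subspace_0[OF subspace_Q_edge]
  by (intro CollectI exI[of _ p] exI[of _ 0]) simp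

lemma Q_edge_in_face_traces: "q \<in> Q_edge v i \<Longrightarrow> q \<in> face_traces i"
  unfolding face_traces_def using subspace_0[OF subspace_polys_on]
  by (intro CollectI exI[of _ 0] exI[of _ q]) simp

lemma quad_grad_in_face_traces:
  assumes "t \<in> quad_index"
  shows "restr (face v i) (\<lambda>x. quad_grad t x \<bullet> \<nu>) \<in> face_traces i"
proof (rule poly_in_face_traces)
  have ij: "fst t \<le> 3" "snd t \<le> 3" using assms by (auto simp: quad_index_def)
  have "restr (face v i) (\<lambda>x. quad_grad t x \<bullet> \<nu>)
      = (glam (snd t) \<bullet> \<nu>) *\<^sub>R restr (face v i) (bary v (fst t)) + (glam (fst t) \<bullet> \<nu>) *\<^sub>R restr (face v i) (bary v (snd t))"
    by (auto simp: quad_grad_def inner_add_left fun_eq_iff restr_def plus_fun_def)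
  also have "\<dots> \<in> polys_on (face v i) 2"
    by (intro subspace_add subspace_scale subspace_polys_on bary_in_polys_on ij)
  finally show "restr (face v i) (\<lambda>x. quad_grad t x \<bullet> \<nu>) \<in> polys_on (face v i) 2" .
qed

lemma cubic_grad_in_face_traces:
  assumes "t \<in> cubic_index"
  shows "restr (face v i) (\<lambda>x. cubic_grad t x \<bullet> \<nu>) \<in> face_traces i"
proof (rule poly_in_face_traces)
  obtain j k where t: "t = (j, k)" and jk: "j \<le> 3" "k \<le> 3" using assms by (auto simp: cubic_index_def)
  define P where "P a b = restr (face v i) (\<lambda>x. bary v a x * bary v b x)" for a b
  have "restr (face v i) (\<lambda>x. cubic_grad t x \<bullet> \<nu>)
      = (2 * (glam j \<bullet> \<nu>) - 2 * (glam k \<bullet> \<nu>)) *\<^sub>R P j k + (glam k \<bullet> \<nu>) *\<^sub>R P j j + (- (glam j \<bullet> \<nu>)) *\<^sub>R P k k"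
    by (auto simp: cubic_grad_def t P_def inner_add_left fun_eq_iff restr_def plus_fun_def algebra_simps power2_eq_square)
  also have "\<dots> \<in> polys_on (face v i) 2"
    unfolding P_def by (intro subspace_add subspace_scale subspace_polys_on quad_in_polys_on jk)
  finally show "restr (face v i) (\<lambda>x. cubic_grad t x \<bullet> \<nu>) \<in> polys_on (face v i) 2" .
qed

text \<open>On the face with all three indices of the bubble the partial derivatives are \<^term>\<open>Phi\<close> functions up to
  the quadratic term \<open>\<lambda>\<^sub>l \<lambda>\<^sub>m\<close>. On the other three faces one of the three coordinates is zero, the
  \<^term>\<open>Phi\<close> functions vanish, and only the quadratic term remains.\<close>

lemma bubble_grad_in_face_traces:
  assumes "t \<in> bubble_index"
  shows "restr (face v i) (\<lambda>x. bubble_grad t x \<bullet> \<nu>) \<in> face_traces i"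
proof -
  obtain l m n where t: "t = (l, m, n)" and ind: "l < m" "m \<le> 3" "n \<le> 3" "n \<noteq> l" "n \<noteq> m"
    using assms by (auto simp: bubble_index_def)
  define F where "F k = restr (face v i) (\<lambda>x. Phi (l, m, n, k) (\<lambda>j. bary v j x))" for k
  define P where "P = restr (face v i) (\<lambda>x. bary v l x * bary v m x)"
  have eq: "restr (face v i) (\<lambda>x. bubble_grad t x \<bullet> \<nu>)
      = (glam n \<bullet> \<nu>) *\<^sub>R F n + (glam n \<bullet> \<nu>) *\<^sub>R P + (glam l \<bullet> \<nu>) *\<^sub>R F l + (glam m \<bullet> \<nu>) *\<^sub>R F m"
    by (auto simp: bubble_grad_def t P_def F_def inner_add_left fun_eq_iff restr_def plus_fun_def algebra_simps
        simp del: Phi.simps)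
  have F: "F k \<in> Q_edge v i" if k: "k \<in> {l, m, n}" for k
  proof (cases "i \<in> {l, m, n}")
    case True
    then have "F k = 0"
      unfolding F_def zero_fun_def by (auto simp: restr_def fun_eq_iff face_def intro!: Phi_eq_0 simp del: Phi.simps)
    then show ?thesis by (simp add: subspace_0 subspace_Q_edge)
  next
    case False
    then have "(l, m, n, k) \<in> face_index i"
      using ind k by (auto simp: face_index_def)
    then show ?thesis
      unfolding F_def Q_edge_def by (intro span_base) blast
  qed
  have "P \<in> face_traces i"
    unfolding P_def using ind by (intro poly_in_face_traces quad_in_polys_on) auto
  moreover have "F k \<in> face_traces i" if "k \<in> {l, m, n}" for k
    using F[OF that] by (rule Q_edge_in_face_traces)
  ultimately show ?thesis
    unfolding eq by (intro subspace_add subspace_scale subspace_face_traces) auto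
qed

lemma normal_derivative_in_face_traces:
  assumes "z \<in> Z3e v"
  shows "restr (face v i) (\<lambda>x. bd_grad v z x \<bullet> \<nu>) \<in> face_traces i"
proof -
  obtain \<alpha> \<beta> \<kappa> where z: "z = restr Int_T (enriched \<alpha> \<beta> \<kappa>)"
    using assms(1) by (auto simp: Z3e_eq)
  have "bd_grad v z x = enriched_grad \<alpha> \<beta> \<kappa> x" if "x \<in> face v i" for x
    using that face_subset_tet unfolding z by (intro bd_grad_eq[OF has_bd_jet_enriched]) auto
  then have "restr (face v i) (\<lambda>x. bd_grad v z x \<bullet> \<nu>) = restr (face v i) (\<lambda>x. enriched_grad \<alpha> \<beta> \<kappa> x \<bullet> \<nu>)"
    by (auto simp: restr_def)
  also have "\<dots> = (\<Sum>t\<in>quad_index. \<alpha> t *\<^sub>R restr (face v i) (\<lambda>x. quad_grad t x \<bullet> \<nu>))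
     + (\<Sum>t\<in>cubic_index. \<beta> t *\<^sub>R restr (face v i) (\<lambda>x. cubic_grad t x \<bullet> \<nu>))
     + (\<Sum>t\<in>bubble_index. \<kappa> t *\<^sub>R restr (face v i) (\<lambda>x. bubble_grad t x \<bullet> \<nu>))"
    by (simp add: enriched_grad_def inner_add_left inner_sum_left restr_add restr_sum restr_scale)
  also have "\<dots> \<in> face_traces i"
    by (intro subspace_add subspace_sum subspace_scale subspace_face_traces
        quad_grad_in_face_traces cubic_grad_in_face_traces bubble_grad_in_face_traces)
  finally show ?thesis .
qed

lemma quad_form_vertex:
  assumes "j \<le> 3"
  shows "(\<Sum>t\<in>quad_index. a t * quad t (v j)) = a (j, j)"
proof -
  have "(\<Sum>t\<in>quad_index. a t * quad t (v j)) = (\<Sum>t\<in>quad_index. if t = (j, j) then a t else 0)"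
    by (rule sum.cong) (use assms in \<open>auto simp: quad_index_def quad_def bary_vertex split: if_splits\<close>)
  then show ?thesis
    using assms finite_quad_index by (simp add: quad_index_def)
qed

lemma quad_form_midpoint:
  assumes "j < k" "k \<le> 3"
  shows "(\<Sum>t\<in>quad_index. a t * quad t (midpoint (v j) (v k))) = (a (j, j) + a (j, k) + a (k, k)) / 4"
proof -
  have "(\<Sum>t\<in>quad_index. a t * quad t (midpoint (v j) (v k)))
      = (\<Sum>t\<in>quad_index. (if t = (j, j) then a t / 4 else 0) + (if t = (j, k) then a t / 4 else 0)
          + (if t = (k, k) then a t / 4 else 0))"
    by (rule sum.cong) (use assms in \<open>auto simp: quad_index_def quad_def bary_vertex bary_midpoint split: if_splits\<close>)
  also have "\<dots> = (a (j, j) + a (j, k) + a (k, k)) / 4"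
    using assms finite_quad_index by (simp add: quad_index_def sum.distrib add_divide_distrib)
  finally show ?thesis .
qed

lemma Phi_sum_eq_0:
  assumes "j \<le> 3" "j \<noteq> i" "bary v j x = 0" "i \<le> 3"
  shows "Phi_sum v i c x = 0"
  unfolding Phi_sum_def
proof (rule sum.neutral, rule)
  fix t assume "t \<in> face_index i"
  obtain l m n k where t: "t = (l, m, n, k)" by (cases t)
  with \<open>t \<in> face_index i\<close> have *: "l < m" "m \<le> 3" "l \<noteq> i" "m \<noteq> i" "n \<le> 3" "n \<notin> {i, l, m}"
    by (simp_all add: face_index_def)
  \<comment> \<open>The indices \<open>i, l, m, n\<close> exhaust the four vertices.\<close>
  have "j = l \<or> j = m \<or> j = n"
  proof -
    have "{i, l, m, n} = {..3}"
      by (rule card_subset_eq) (use * assms in auto)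
    then show ?thesis using assms by auto
  qed
  then have "Phi (l, m, n, k) (\<lambda>j. bary v j x) = 0"
    using assms(3) by (intro Phi_eq_0) auto
  then show "c t * Phi t (\<lambda>j. bary v j x) = 0"
    by (simp add: t del: Phi.simps)
qed

text \<open>The values at the three vertices and three edge midpoints of the face kill all six coefficients of
  the quadratic polynomial.\<close>

lemma polys_on_Int_Q_edge:
  assumes "i \<le> 3" "q \<in> Q_edge v i" "q \<in> polys_on (face v i) 2"
  shows "q = 0"
proof -
  obtain c where c: "q = restr (face v i) (Phi_sum v i c)"
    using assms(2) by (auto simp: Q_edge_eq)
  obtain a where a: "q = restr (face v i) (\<lambda>x. \<Sum>t\<in>quad_index. a t * quad t x)"
    using assms(3) by (auto simp: polys_on_2)
  have zero: "(\<Sum>t\<in>quad_index. a t * quad t x) = 0"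
    if x: "x \<in> face v i" and j: "j \<le> 3" "j \<noteq> i" "bary v j x = 0" for x j
  proof -
    have "(\<Sum>t\<in>quad_index. a t * quad t x) = q x" using x by (simp add: a restr_def)
    also have "\<dots> = Phi_sum v i c x" using x by (simp add: c restr_def)
    also have "\<dots> = 0" using Phi_sum_eq_0 j assms(1) by blast
    finally show ?thesis .
  qed
  have diag: "a (j, j) = 0" if j: "j \<le> 3" "j \<noteq> i" for j
  proof -
    obtain l where l: "l \<le> 3" "l \<noteq> i" "l \<noteq> j" using exists_fourth_index[of i j j] by auto
    have "v j \<in> face v i"
      using j assms(1) by (simp add: face_def vertex_in_tet bary_vertex)
    then show ?thesis
      using zero[of "v j" l] l j by (simp add: quad_form_vertex bary_vertex)
  qed
  have offdiag: "a (j, k) = 0" if jk: "j < k" "k \<le> 3" "j \<noteq> i" "k \<noteq> i" for j k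
  proof -
    obtain l where l: "l \<le> 3" "l \<noteq> i" "l \<noteq> j" "l \<noteq> k" using exists_fourth_index[of i j k] by auto
    have "midpoint (v j) (v k) \<in> face v i"
      using jk assms(1) by (simp add: face_def midpoint_in_tet bary_vertex bary_midpoint)
    then have "(a (j, j) + a (j, k) + a (k, k)) / 4 = 0"
      using zero[of "midpoint (v j) (v k)" l] l jk
      by (simp only: quad_form_midpoint) (simp add: bary_vertex bary_midpoint)
    then show ?thesis using diag jk by simp
  qed
  have "a t * quad t x = 0" if "t \<in> quad_index" "x \<in> face v i" for t x
  proof -
    obtain j k where t: "t = (j, k)" "j \<le> k" "k \<le> 3" using \<open>t \<in> quad_index\<close> by (auto simp: quad_index_def)
    show ?thesis
    proof (cases "j = i \<or> k = i")
      case True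
      then show ?thesis using \<open>x \<in> face v i\<close> by (auto simp: t quad_def face_def)
    next
      case False
      then show ?thesis using diag offdiag t by (cases "j = k") auto
    qed
  qed
  then show ?thesis
    by (auto simp: a restr_def fun_eq_iff zero_fun_def intro!: sum.neutral)
qed

lemma q_part_eqI:
  assumes "i \<le> 3" "p \<in> polys_on (face v i) 2" "q \<in> Q_edge v i"
    "restr (face v i) (\<lambda>x. bd_grad v z x \<bullet> outer_normal v i) = p + q"
  shows "q_part v i z = q"
  unfolding q_part_def
proof (rule the_equality)
  fix q' assume *: "q' \<in> Q_edge v i \<and> (\<exists>p\<in>polys_on (face v i) 2. restr (face v i) (\<lambda>x. bd_grad v z x \<bullet> outer_normal v i) = p + q')"
  then obtain p' where "p' \<in> polys_on (face v i) 2" "p + q = p' + q'"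
    using assms(4) by auto
  then have "q' - q = p - p'" by (simp add: algebra_simps)
  moreover have "q' - q \<in> Q_edge v i" using * assms(3) by (blast intro: subspace_diff subspace_Q_edge)
  moreover have "p - p' \<in> polys_on (face v i) 2"
    using \<open>p' \<in> _\<close> assms(2) by (blast intro: subspace_diff subspace_polys_on)
  ultimately show "q' = q"
    using polys_on_Int_Q_edge[OF assms(1), of "q' - q"] by simp
qed (use assms in blast)

lemma q_part_decomposition:
  assumes "i \<le> 3" "z \<in> Z3e v"
  shows "q_part v i z \<in> Q_edge v i"
    and "\<exists>p\<in>polys_on (face v i) 2. restr (face v i) (\<lambda>x. bd_grad v z x \<bullet> outer_normal v i) = p + q_part v i z"
proof -
  obtain p q where pq: "p \<in> polys_on (face v i) 2" "q \<in> Q_edge v i"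
    "restr (face v i) (\<lambda>x. bd_grad v z x \<bullet> outer_normal v i) = p + q"
    using normal_derivative_in_face_traces[OF assms(2)] unfolding face_traces_def by blast
  have "q_part v i z = q" using q_part_eqI[OF assms(1) pq] .
  with pq show "q_part v i z \<in> Q_edge v i"
    "\<exists>p\<in>polys_on (face v i) 2. restr (face v i) (\<lambda>x. bd_grad v z x \<bullet> outer_normal v i) = p + q_part v i z"
    by auto
qed

lemma jet_linear_Z3e:
  assumes "z \<in> Z3e v" "w \<in> Z3e v" "p \<in> tet v"
  shows "bd_val v (a *\<^sub>R z + b *\<^sub>R w) p = a * bd_val v z p + b * bd_val v w p"
    and "bd_grad v (a *\<^sub>R z + b *\<^sub>R w) p = a *\<^sub>R bd_grad v z p + b *\<^sub>R bd_grad v w p"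
proof -
  have eq: "a *\<^sub>R z + b *\<^sub>R w = (\<lambda>x. a * z x + b * w x)" by (simp add: fun_eq_iff plus_fun_def)
  have "has_bd_jet (a *\<^sub>R z + b *\<^sub>R w) p (a * bd_val v z p + b * bd_val v w p) (a *\<^sub>R bd_grad v z p + b *\<^sub>R bd_grad v w p)"
    unfolding eq by (intro has_bd_jet_add has_bd_jet_scale Z3e_jet assms)
  then show "bd_val v (a *\<^sub>R z + b *\<^sub>R w) p = a * bd_val v z p + b * bd_val v w p"
    "bd_grad v (a *\<^sub>R z + b *\<^sub>R w) p = a *\<^sub>R bd_grad v z p + b *\<^sub>R bd_grad v w p"
    using bd_val_eq bd_grad_eq assms(3) by blast+
qed

lemma q_part_linear:
  assumes "i \<le> 3" "z \<in> Z3e v" "w \<in> Z3e v"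
  shows "q_part v i (a *\<^sub>R z + b *\<^sub>R w) = a *\<^sub>R q_part v i z + b *\<^sub>R q_part v i w"
proof -
  let ?N = "\<lambda>z. restr (face v i) (\<lambda>x. bd_grad v z x \<bullet> outer_normal v i)"
  obtain p r where p: "p \<in> polys_on (face v i) 2" "?N z = p + q_part v i z"
    and r: "r \<in> polys_on (face v i) 2" "?N w = r + q_part v i w"
    using q_part_decomposition(2) assms by meson
  have "?N (a *\<^sub>R z + b *\<^sub>R w) = a *\<^sub>R ?N z + b *\<^sub>R ?N w"
    using face_subset_tet jet_linear_Z3e(2)[OF assms(2,3)]
    by (auto simp: restr_def fun_eq_iff plus_fun_def inner_add_left subset_eq)
  also have "\<dots> = (a *\<^sub>R p + b *\<^sub>R r) + (a *\<^sub>R q_part v i z + b *\<^sub>R q_part v i w)"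
    unfolding p r by (simp add: scaleR_add_right ac_simps)
  finally have eq: "?N (a *\<^sub>R z + b *\<^sub>R w) = (a *\<^sub>R p + b *\<^sub>R r) + (a *\<^sub>R q_part v i z + b *\<^sub>R q_part v i w)" .
  show ?thesis
    by (rule q_part_eqI[OF assms(1) _ _ eq])
       (intro subspace_add subspace_scale subspace_polys_on subspace_Q_edge p(1) r(1) q_part_decomposition(1) assms)+
qed

section \<open>The normal lift is linear\<close>

text \<open>The central projection from the vertex \<open>v\<^sub>i\<close>: it leaves the ratios of the other coordinates
  unchanged, so homogeneous expressions in them can be evaluated on the face.\<close>

lemma exists_projection_to_face:
  assumes "i \<le> 3" "x \<in> Int_T"
  shows "\<exists>s y. s > 0 \<and> y \<in> face v i \<and> (\<forall>j\<le>3. j \<noteq> i \<longrightarrow> bary v j x = s * bary v j y)"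
proof -
  define s where "s = (\<Sum>j\<in>{..3} - {i}. bary v j x)"
  have ne: "{..3} - {i} \<noteq> {}"
    using card_Diff_singleton[of i "{..3}"] assms(1) by force
  have s: "s > 0"
    unfolding s_def by (rule sum_pos) (use ne assms(2) bary_pos in auto)
  define c where "c j = (if j = i then 0 else bary v j x / s)" for j
  have "(\<Sum>j\<le>3. c j) = (\<Sum>j\<in>{..3} - {i}. bary v j x / s)"
    using assms(1) by (subst sum.remove[of _ i]) (auto simp: c_def)
  also have "\<dots> = 1" using s by (simp add: sum_divide_distrib[symmetric] s_def[symmetric])
  finally obtain y where y: "\<forall>j\<le>3. bary v j y = c j"
    using exists_point_with_bary by blast
  have "y \<in> face v i"
    using y assms bary_pos[OF assms(2)] s by (auto simp: face_def tet_iff c_def less_imp_le)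
  then show ?thesis
    using s y by (intro exI[of _ s] exI[of _ y]) (auto simp: c_def)
qed

lemma Phi_sum_scaling:
  assumes "s > 0" "\<forall>j\<le>3. j \<noteq> i \<longrightarrow> bary v j x = s * bary v j y"
  shows "Phi_sum v i c x = s\<^sup>2 * Phi_sum v i c y"
  unfolding Phi_sum_def sum_distrib_left
proof (rule sum.cong[OF refl])
  fix t assume "t \<in> face_index i"
  obtain l m n k where t: "t = (l, m, n, k)" by (cases t)
  with \<open>t \<in> face_index i\<close> have *: "l \<le> 3" "m \<le> 3" "l \<noteq> i" "m \<noteq> i" "n \<le> 3" "n \<noteq> i"
    by (simp_all add: face_index_def)
  have "Phi t (\<lambda>j. bary v j x) = Phi t (\<lambda>j. s * bary v j y)"
    unfolding t by (rule Phi_cong) (use * assms(2) in auto)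
  then show "c t * Phi t (\<lambda>j. bary v j x) = s\<^sup>2 * (c t * Phi t (\<lambda>j. bary v j y))"
    using Phi_homogeneous[of s] assms(1) by simp
qed

lemma bary_ext_Phi_sum:
  assumes "q \<in> Q_edge v i"
  shows "\<exists>c. q = restr (face v i) (Phi_sum v i c) \<and> bary_ext v i q = Phi_sum v i c"
proof -
  have "\<exists>c. q = restr (face v i) (Phi_sum v i c)" using assms by (auto simp: Q_edge_eq)
  then have "q = restr (face v i) (Phi_sum v i (SOME c. q = restr (face v i) (Phi_sum v i c)))"
    by (rule someI_ex)
  then show ?thesis unfolding bary_ext_def by blast
qed

text \<open>The extension of \<open>q\<close> depends only on \<open>q\<close> and not on the coefficients chosen to represent it. This makes the lift linear.\<close>

lemma bary_ext_scaling:
  assumes "q \<in> Q_edge v i" "s > 0" "y \<in> face v i" "\<forall>j\<le>3. j \<noteq> i \<longrightarrow> bary v j x = s * bary v j y"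
  shows "bary_ext v i q x = s\<^sup>2 * q y"
proof -
  obtain c where c: "q = restr (face v i) (Phi_sum v i c)" "bary_ext v i q = Phi_sum v i c"
    using bary_ext_Phi_sum[OF assms(1)] by blast
  have "q y = Phi_sum v i c y" using c(1) assms(3) by (simp add: restr_def)
  then show ?thesis using Phi_sum_scaling[OF assms(2,4)] c(2) by simp
qed

lemma normal_lift_linear:
  assumes "i \<le> 3" "q \<in> Q_edge v i" "r \<in> Q_edge v i"
  shows "normal_lift v i (a *\<^sub>R q + b *\<^sub>R r) = a *\<^sub>R normal_lift v i q + b *\<^sub>R normal_lift v i r"
proof -
  have "bary_ext v i (a *\<^sub>R q + b *\<^sub>R r) x = a * bary_ext v i q x + b * bary_ext v i r x" if x: "x \<in> Int_T" for x
  proof -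
    obtain s y where *: "s > 0" "y \<in> face v i" "\<forall>j\<le>3. j \<noteq> i \<longrightarrow> bary v j x = s * bary v j y"
      using exists_projection_to_face[OF assms(1) x] by blast
    have "a *\<^sub>R q + b *\<^sub>R r \<in> Q_edge v i"
      using assms by (intro subspace_add subspace_scale subspace_Q_edge)
    then show ?thesis
      using bary_ext_scaling[OF _ *] assms by (simp add: plus_fun_def algebra_simps)
  qed
  then show ?thesis
    by (auto simp: normal_lift_def restr_def fun_eq_iff plus_fun_def algebra_simps add_divide_distrib)
qed

lemma R_T_linear:
  assumes "z \<in> Z3e v" "w \<in> Z3e v"
  shows "R_T v (a *\<^sub>R z + b *\<^sub>R w) = a *\<^sub>R R_T v z + b *\<^sub>R R_T v w"
proof -
  have "normal_lift v i (q_part v i (a *\<^sub>R z + b *\<^sub>R w))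
      = a *\<^sub>R normal_lift v i (q_part v i z) + b *\<^sub>R normal_lift v i (q_part v i w)" if "i \<le> 3" for i
    using that assms by (simp add: q_part_linear normal_lift_linear q_part_decomposition)
  then show ?thesis
    by (simp add: R_T_def sum.distrib scaleR_sum_right[symmetric] algebra_simps)
qed

end

section \<open>Normal lifts are flat along the edges\<close>

text \<open>With \<open>d = \<lambda>\<^sub>i\<close>, the expression is \<open>\<lambda>\<^sub>i\<Theta>\<^sub>i\<close>. Each of the four variables can be pulled out, and it
  leaves a product of three factors that are at most one.\<close>

lemma weighted_ratio_le:
  fixes a b c d :: real
  assumes "a > 0" "b > 0" "c > 0" "d > 0"
  shows "d * (a / (d + a) * (b / (d + b) * (c / (d + c)))) \<le> d"
    and "d * (a / (d + a) * (b / (d + b) * (c / (d + c)))) \<le> a"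
    and "d * (a / (d + a) * (b / (d + b) * (c / (d + c)))) \<le> b"
    and "d * (a / (d + a) * (b / (d + b) * (c / (d + c)))) \<le> c"
proof -
  have r: "x / (x + y) \<le> 1" "y / (x + y) \<le> 1" "0 \<le> x / (x + y)" "0 \<le> y / (x + y)" if "x > 0" "y > 0" for x y :: real
    using that by auto
  have p: "x * (p * (q * r)) \<le> x" if "x > 0" "0 \<le> p" "p \<le> 1" "0 \<le> q" "q \<le> 1" "0 \<le> r" "r \<le> 1" for x p q r :: real
  proof -
    have "p * (q * r) \<le> 1 * (1 * 1)" using that by (intro mult_mono) auto
    then show ?thesis using that by simp
  qed
  show "d * (a / (d + a) * (b / (d + b) * (c / (d + c)))) \<le> d"
    using assms by (intro p r) auto
  have "a * (d / (d + a) * (b / (d + b) * (c / (d + c)))) \<le> a"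
    using assms by (intro p r) auto
  then show "d * (a / (d + a) * (b / (d + b) * (c / (d + c)))) \<le> a" by (simp add: mult_ac)
  have "b * (d / (d + b) * (a / (d + a) * (c / (d + c)))) \<le> b"
    using assms by (intro p r) auto
  then show "d * (a / (d + a) * (b / (d + b) * (c / (d + c)))) \<le> b" by (simp add: mult_ac)
  have "c * (d / (d + c) * (a / (d + a) * (b / (d + b)))) \<le> c"
    using assms by (intro p r) auto
  then show "d * (a / (d + a) * (b / (d + b) * (c / (d + c)))) \<le> c" by (simp add: mult_ac)
qed

lemma Phi_bound_le:
  fixes a b c :: real
  assumes "a > 0" "b > 0" "c > 0"
  shows "2 * a * b * c / ((a + b) * (a + c)) \<le> 2 * a" "2 * a * b * c / ((a + b) * (a + c)) \<le> 2 * b"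
    "2 * a * b * c / ((a + b) * (a + c)) \<le> 2 * c"
proof -
  have P: "(a + b) * (a + c) > 0" using assms by simp
  show "2 * a * b * c / ((a + b) * (a + c)) \<le> 2 * a" "2 * a * b * c / ((a + b) * (a + c)) \<le> 2 * b"
    "2 * a * b * c / ((a + b) * (a + c)) \<le> 2 * c"
    unfolding pos_divide_le_eq[OF P] using assms by (simp_all add: algebra_simps)
qed

lemma Phi_side_bound:
  fixes a b c :: real
  assumes "a > 0" "b > 0" "c > 0" "c \<le> 1"
  shows "a * b * c\<^sup>2 * (2 * a + b) / ((a + b)\<^sup>2 * (a + c)) \<le> 2 * a * b * c / ((a + b) * (a + c))"
proof -
  have "a * b * c\<^sup>2 * (2 * a + b) / ((a + b)\<^sup>2 * (a + c)) = a * b * c / ((a + b) * (a + c)) * (c * ((2 * a + b) / (a + b)))"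
    by (simp add: power2_eq_square mult_ac)
  also have "\<dots> \<le> a * b * c / ((a + b) * (a + c)) * (1 * 2)"
    using assms by (intro mult_left_mono mult_mono) (auto simp: divide_simps)
  finally show ?thesis by (simp add: mult_ac)
qed

text \<open>Carrying out the subtraction leaves a single quotient with a numerator of constant sign; the
  calculus below applies to such expressions only.\<close>

lemma Phi_opposite_eq:
  fixes a b c :: real
  assumes "a > 0" "b > 0" "c > 0"
  shows "b\<^sup>2 * c\<^sup>2 * (b * c - a\<^sup>2) / ((a + b)\<^sup>2 * (a + c)\<^sup>2) - b * c
    = - (a * b * c * (a * b * c + 2 * b * c * (a + b + c) + a * (a + b + c) * (a + b + c)) / (((a + b) * (a + c)) * ((a + b) * (a + c))))"
proof -
  let ?Q = "((a + b) * (a + c)) * ((a + b) * (a + c))"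
  have "(a + b)\<^sup>2 * (a + c)\<^sup>2 = ?Q"
    by (simp add: power2_eq_square)
  moreover have "X / ?Q - Y = (X - Y * ?Q) / ?Q" for X Y
    using assms by (simp add: diff_divide_distrib)
  moreover have "b\<^sup>2 * c\<^sup>2 * (b * c - a\<^sup>2) - b * c * ?Q
    = - (a * b * c * (a * b * c + 2 * b * c * (a + b + c) + a * (a + b + c) * (a + b + c)))"
    by algebra
  ultimately show ?thesis
    by (simp only: minus_divide_left)
qed

text \<open>With \<open>s = a + b + c\<close>, the denominator factor \<open>(a + b)(a + c)\<close> equals \<open>bc + as\<close>, which is what the long
  factor of the numerator is compared with.\<close>

lemma Phi_opposite_bound:
  fixes a b c :: real
  assumes "a > 0" "b > 0" "c > 0" "a + b + c \<le> 1"
  shows "a * b * c * (a * b * c + 2 * b * c * (a + b + c) + a * (a + b + c) * (a + b + c)) / (((a + b) * (a + c)) * ((a + b) * (a + c)))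
    \<le> 2 * a * b * c / ((a + b) * (a + c))"
proof -
  let ?s = "a + b + c" and ?P = "(a + b) * (a + c)"
  have P: "?P > 0" using assms by simp
  have "a * b * c + 2 * b * c * ?s + a * ?s * ?s \<le> 2 * ?s * ?P"
    using assms by (simp add: algebra_simps)
  also have "\<dots> \<le> 2 * 1 * ?P"
    using assms P by (intro mult_right_mono mult_left_mono) auto
  finally have *: "(a * b * c + 2 * b * c * ?s + a * ?s * ?s) / ?P \<le> 2"
    using P by (simp add: divide_le_eq)
  have "a * b * c * (a * b * c + 2 * b * c * ?s + a * ?s * ?s) / (?P * ?P)
     = a * b * c / ?P * ((a * b * c + 2 * b * c * ?s + a * ?s * ?s) / ?P)"
    by simp
  also have "\<dots> \<le> a * b * c / ?P * 2"
    using assms P * by (intro mult_left_mono) auto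
  finally show ?thesis by (simp add: mult_ac)
qed

context tetrahedron
begin

text \<open>Positive functions whose logarithmic derivatives with respect to \<open>log \<lambda>\<^sub>k\<close> are bounded. The \<open>D k\<close> are
  partial derivatives of a representation of \<open>f\<close> in the four coordinates; they are not
  unique because the \<open>\<nabla>\<lambda>\<^sub>k\<close> are linearly dependent. The class is closed under sums, products and
  quotients, and it contains the coordinates and the positive constants.\<close>

definition log_bounded :: "(real^3 \<Rightarrow> real) \<Rightarrow> bool"
  where "log_bounded f \<longleftrightarrow> (\<exists>C. \<forall>x\<in>Int_T. 0 < f x \<and>
    (\<exists>D. GDERIV f x :> (\<Sum>k\<le>3. D k *\<^sub>R glam k) \<and> (\<forall>k\<le>3. \<bar>D k\<bar> * bary v k x \<le> C * f x)))"

lemma log_boundedE: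
  assumes "log_bounded f"
  obtains C D where "C \<ge> 0" "\<And>x. x \<in> Int_T \<Longrightarrow> 0 < f x"
    "\<And>x. x \<in> Int_T \<Longrightarrow> GDERIV f x :> (\<Sum>k\<le>3. D x k *\<^sub>R glam k)"
    "\<And>x k. x \<in> Int_T \<Longrightarrow> k \<le> 3 \<Longrightarrow> \<bar>D x k\<bar> * bary v k x \<le> C * f x"
proof -
  from assms obtain C D where *: "\<forall>x\<in>Int_T. 0 < f x \<and> GDERIV f x :> (\<Sum>k\<le>3. D x k *\<^sub>R glam k) \<and>
      (\<forall>k\<le>3. \<bar>D x k\<bar> * bary v k x \<le> C * f x)"
    unfolding log_bounded_def by metis
  obtain x where x: "x \<in> Int_T" using Int_T_nonempty by blast
  have "0 \<le> \<bar>D x 0\<bar> * bary v 0 x" using bary_pos[OF x, of 0] by simp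
  also have "\<dots> \<le> C * f x" using * x by blast
  finally have "C \<ge> 0" using * x by (simp add: zero_le_mult_iff) (metis less_le_not_le)
  then show ?thesis using that[of C D] * by blast
qed

lemma log_bounded_const: "c > 0 \<Longrightarrow> log_bounded (\<lambda>x. c)"
  unfolding log_bounded_def by (intro exI[of _ "0::real"] ballI conjI exI[of _ "\<lambda>_. 0"]) (auto simp: GDERIV_const)

lemma log_bounded_bary:
  assumes "i \<le> 3"
  shows "log_bounded (bary v i)"
  unfolding log_bounded_def
proof (intro exI[of _ "1::real"] ballI conjI exI[of _ "\<lambda>k. if k = i then 1 else 0"])
  fix x assume x: "x \<in> Int_T"
  have "(\<Sum>k\<le>3. (if k = i then 1 else (0::real)) *\<^sub>R glam k) = (\<Sum>k\<le>3. if k = i then glam k else 0)"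
    by (rule sum.cong) auto
  then show "GDERIV (bary v i) x :> (\<Sum>k\<le>3. (if k = i then 1 else 0) *\<^sub>R glam k)"
    using assms bary_has_derivative[OF assms, of x UNIV] by (simp add: gderiv_def)
  show "0 < bary v i x" using bary_pos x assms by blast
  then show "\<forall>k\<le>3. \<bar>if k = i then 1 else 0\<bar> * bary v k x \<le> 1 * bary v i x"
    by auto
qed

lemma log_bounded_add:
  assumes "log_bounded f" "log_bounded g"
  shows "log_bounded (\<lambda>x. f x + g x)"
proof -
  obtain C D where f: "C \<ge> 0" "\<And>x. x \<in> Int_T \<Longrightarrow> 0 < f x"
    "\<And>x. x \<in> Int_T \<Longrightarrow> GDERIV f x :> (\<Sum>k\<le>3. D x k *\<^sub>R glam k)"
    "\<And>x k. x \<in> Int_T \<Longrightarrow> k \<le> 3 \<Longrightarrow> \<bar>D x k\<bar> * bary v k x \<le> C * f x"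
    by (rule log_boundedE[OF assms(1)], rule that, assumption+)
  obtain B E where g: "B \<ge> 0" "\<And>x. x \<in> Int_T \<Longrightarrow> 0 < g x"
    "\<And>x. x \<in> Int_T \<Longrightarrow> GDERIV g x :> (\<Sum>k\<le>3. E x k *\<^sub>R glam k)"
    "\<And>x k. x \<in> Int_T \<Longrightarrow> k \<le> 3 \<Longrightarrow> \<bar>E x k\<bar> * bary v k x \<le> B * g x"
    by (rule log_boundedE[OF assms(2)], rule that, assumption+)
  show ?thesis
    unfolding log_bounded_def
  proof (intro exI[of _ "C + B"] ballI conjI)
    fix x assume x: "x \<in> Int_T"
    show "0 < f x + g x" using f g x by (simp add: add_pos_pos)
    show "\<exists>F. GDERIV (\<lambda>x. f x + g x) x :> (\<Sum>k\<le>3. F k *\<^sub>R glam k) \<and>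
       (\<forall>k\<le>3. \<bar>F k\<bar> * bary v k x \<le> (C + B) * (f x + g x))"
    proof (intro exI[of _ "\<lambda>k. D x k + E x k"] conjI allI impI)
      show "GDERIV (\<lambda>x. f x + g x) x :> (\<Sum>k\<le>3. (D x k + E x k) *\<^sub>R glam k)"
        using GDERIV_add[OF f(3)[OF x] g(3)[OF x]] by (simp add: scaleR_add_left sum.distrib)
      fix k :: nat assume k: "k \<le> 3"
      have "\<bar>D x k + E x k\<bar> * bary v k x \<le> (\<bar>D x k\<bar> + \<bar>E x k\<bar>) * bary v k x"
        using bary_pos[OF x k] by (intro mult_right_mono) auto
      also have "\<dots> \<le> C * f x + B * g x"
        using f(4)[OF x k] g(4)[OF x k] by (simp add: distrib_right)
      also have "\<dots> \<le> (C + B) * (f x + g x)"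
        using f(1) f(2)[OF x] g(1) g(2)[OF x] by (simp add: algebra_simps)
      finally show "\<bar>D x k + E x k\<bar> * bary v k x \<le> (C + B) * (f x + g x)" .
    qed
  qed
qed

lemma log_bounded_mult:
  assumes "log_bounded f" "log_bounded g"
  shows "log_bounded (\<lambda>x. f x * g x)"
proof -
  obtain C D where f: "C \<ge> 0" "\<And>x. x \<in> Int_T \<Longrightarrow> 0 < f x"
    "\<And>x. x \<in> Int_T \<Longrightarrow> GDERIV f x :> (\<Sum>k\<le>3. D x k *\<^sub>R glam k)"
    "\<And>x k. x \<in> Int_T \<Longrightarrow> k \<le> 3 \<Longrightarrow> \<bar>D x k\<bar> * bary v k x \<le> C * f x"
    by (rule log_boundedE[OF assms(1)], rule that, assumption+)
  obtain B E where g: "B \<ge> 0" "\<And>x. x \<in> Int_T \<Longrightarrow> 0 < g x"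
    "\<And>x. x \<in> Int_T \<Longrightarrow> GDERIV g x :> (\<Sum>k\<le>3. E x k *\<^sub>R glam k)"
    "\<And>x k. x \<in> Int_T \<Longrightarrow> k \<le> 3 \<Longrightarrow> \<bar>E x k\<bar> * bary v k x \<le> B * g x"
    by (rule log_boundedE[OF assms(2)], rule that, assumption+)
  show ?thesis
    unfolding log_bounded_def
  proof (intro exI[of _ "C + B"] ballI conjI)
    fix x assume x: "x \<in> Int_T"
    show "0 < f x * g x" using f g x by simp
    show "\<exists>F. GDERIV (\<lambda>x. f x * g x) x :> (\<Sum>k\<le>3. F k *\<^sub>R glam k) \<and>
       (\<forall>k\<le>3. \<bar>F k\<bar> * bary v k x \<le> (C + B) * (f x * g x))"
    proof (intro exI[of _ "\<lambda>k. f x * E x k + g x * D x k"] conjI allI impI)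
      show "GDERIV (\<lambda>x. f x * g x) x :> (\<Sum>k\<le>3. (f x * E x k + g x * D x k) *\<^sub>R glam k)"
        using GDERIV_mult[OF f(3)[OF x] g(3)[OF x]]
        by (simp add: scaleR_add_left sum.distrib scaleR_sum_right)
      fix k :: nat assume k: "k \<le> 3"
      have "\<bar>f x * E x k + g x * D x k\<bar> \<le> f x * \<bar>E x k\<bar> + g x * \<bar>D x k\<bar>"
        using f(2)[OF x] g(2)[OF x] abs_triangle_ineq[of "f x * E x k" "g x * D x k"] by (simp add: abs_mult)
      then have "\<bar>f x * E x k + g x * D x k\<bar> * bary v k x \<le> (f x * \<bar>E x k\<bar> + g x * \<bar>D x k\<bar>) * bary v k x"
        using bary_pos[OF x k] by (intro mult_right_mono) auto
      also have "\<dots> = f x * (\<bar>E x k\<bar> * bary v k x) + g x * (\<bar>D x k\<bar> * bary v k x)"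
        by (simp add: algebra_simps)
      also have "\<dots> \<le> f x * (B * g x) + g x * (C * f x)"
        using f(2)[OF x] g(2)[OF x] f(4)[OF x k] g(4)[OF x k] by (intro add_mono mult_left_mono) auto
      finally show "\<bar>f x * E x k + g x * D x k\<bar> * bary v k x \<le> (C + B) * (f x * g x)"
        by (simp add: algebra_simps)
    qed
  qed
qed

lemma log_bounded_divide:
  assumes "log_bounded f" "log_bounded g"
  shows "log_bounded (\<lambda>x. f x / g x)"
proof -
  obtain B E where g: "B \<ge> 0" "\<And>x. x \<in> Int_T \<Longrightarrow> 0 < g x"
    "\<And>x. x \<in> Int_T \<Longrightarrow> GDERIV g x :> (\<Sum>k\<le>3. E x k *\<^sub>R glam k)"
    "\<And>x k. x \<in> Int_T \<Longrightarrow> k \<le> 3 \<Longrightarrow> \<bar>E x k\<bar> * bary v k x \<le> B * g x"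
    by (rule log_boundedE[OF assms(2)], rule that, assumption+)
  have "log_bounded (\<lambda>x. inverse (g x))"
    unfolding log_bounded_def
  proof (intro exI[of _ B] ballI conjI)
    fix x assume x: "x \<in> Int_T"
    have gp: "g x > 0" using g(2)[OF x] .
    then show "0 < inverse (g x)" by simp
    show "\<exists>F. GDERIV (\<lambda>x. inverse (g x)) x :> (\<Sum>k\<le>3. F k *\<^sub>R glam k) \<and>
       (\<forall>k\<le>3. \<bar>F k\<bar> * bary v k x \<le> B * inverse (g x))"
    proof (intro exI[of _ "\<lambda>k. - (inverse (g x))\<^sup>2 * E x k"] conjI allI impI)
      show "GDERIV (\<lambda>x. inverse (g x)) x :> (\<Sum>k\<le>3. (- (inverse (g x))\<^sup>2 * E x k) *\<^sub>R glam k)"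
        using GDERIV_inverse[OF g(3)[OF x]] gp
        by (simp add: scaleR_sum_right sum_negf)
      fix k :: nat assume k: "k \<le> 3"
      have "\<bar>- (inverse (g x))\<^sup>2 * E x k\<bar> * bary v k x = (inverse (g x))\<^sup>2 * (\<bar>E x k\<bar> * bary v k x)"
        by (simp add: abs_mult)
      also have "\<dots> \<le> (inverse (g x))\<^sup>2 * (B * g x)"
        using g(4)[OF x k] by (intro mult_left_mono) auto
      also have "\<dots> = B * inverse (g x)"
        using gp by (simp add: power2_eq_square)
      finally show "\<bar>- (inverse (g x))\<^sup>2 * E x k\<bar> * bary v k x \<le> B * inverse (g x)" .
    qed
  qed
  from log_bounded_mult[OF assms(1) this] show ?thesis
    by (simp add: divide_inverse)
qed

lemma log_bounded_power2: "log_bounded f \<Longrightarrow> log_bounded (\<lambda>x. (f x)\<^sup>2)"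
  using log_bounded_mult by (simp add: power2_eq_square)

lemma bary_le_1:
  assumes "x \<in> Int_T" "i \<le> 3"
  shows "bary v i x \<le> 1"
proof -
  have "bary v i x \<le> (\<Sum>k\<le>3. bary v k x)"
    using assms bary_pos[OF assms(1)] by (intro member_le_sum) (auto simp: less_imp_le)
  then show ?thesis by (simp add: bary_sums)
qed

text \<open>Since \<open>\<bar>\<partial>\<^sub>k f\<bar> \<le> C f / \<lambda>\<^sub>k \<le> C h\<close>, a bound on the function alone controls its gradient.\<close>

lemma has_bd_jet_flat:
  assumes f: "log_bounded f" and h: "(h \<longlongrightarrow> 0) (at p within Int_T)"
    and bound: "\<And>x k. x \<in> Int_T \<Longrightarrow> k \<le> 3 \<Longrightarrow> f x \<le> bary v k x * h x"
  shows "has_bd_jet f p 0 0"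
proof -
  obtain C D where f: "C \<ge> 0" "\<And>x. x \<in> Int_T \<Longrightarrow> 0 < f x"
    "\<And>x. x \<in> Int_T \<Longrightarrow> GDERIV f x :> (\<Sum>k\<le>3. D x k *\<^sub>R glam k)"
    "\<And>x k. x \<in> Int_T \<Longrightarrow> k \<le> 3 \<Longrightarrow> \<bar>D x k\<bar> * bary v k x \<le> C * f x"
    by (rule log_boundedE[OF assms(1)], rule that, assumption+)
  have hpos: "h x > 0" if "x \<in> Int_T" for x
    using bound[OF that, of 0] f(2)[OF that] bary_pos[OF that, of 0]
    by (metis le0 less_le_trans zero_less_mult_pos)
  have D: "\<bar>D x k\<bar> \<le> C * h x" if "x \<in> Int_T" "k \<le> 3" for x k
  proof -
    have "\<bar>D x k\<bar> * bary v k x \<le> C * (bary v k x * h x)"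
      using f(4)[OF that] mult_left_mono[OF bound[OF that] f(1)] by linarith
    then have "\<bar>D x k\<bar> * bary v k x \<le> (C * h x) * bary v k x" by (simp add: mult_ac)
    then show ?thesis using bary_pos[OF that] by simp
  qed
  have "norm (\<Sum>k\<le>3. D x k *\<^sub>R glam k) \<le> (\<Sum>k\<le>3. C * norm (glam k)) * h x" if "x \<in> Int_T" for x
  proof -
    have "norm (\<Sum>k\<le>3. D x k *\<^sub>R glam k) \<le> (\<Sum>k\<le>3. C * h x * norm (glam k))"
      using D[OF that] by (intro sum_norm_le) (auto intro!: mult_right_mono)
    then show ?thesis by (simp add: sum_distrib_left mult_ac)
  qed
  then have "((\<lambda>x. \<Sum>k\<le>3. D x k *\<^sub>R glam k) \<longlongrightarrow> 0) (at p within Int_T)"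
    by (intro Lim_null_comparison[OF _ tendsto_mult_right_zero[OF h, of "\<Sum>k\<le>3. C * norm (glam k)"]])
       (simp add: eventually_at_filter)
  moreover have "(f \<longlongrightarrow> 0) (at p within Int_T)"
  proof (rule Lim_null_comparison[OF _ h])
    have "norm (f x) \<le> h x" if "x \<in> Int_T" for x
    proof -
      have "f x \<le> bary v 0 x * h x" using bound that by blast
      also have "\<dots> \<le> 1 * h x"
        using bary_le_1 that hpos[OF that] by (intro mult_right_mono) auto
      finally show ?thesis using f(2)[OF that] by simp
    qed
    then show "\<forall>\<^sub>F x in at p within Int_T. norm (f x) \<le> h x"
      by (simp add: eventually_at_filter)
  qed
  ultimately show ?thesis
    unfolding has_bd_jet_def using f(3)
    by (intro conjI exI[of _ "\<lambda>x. \<Sum>k\<le>3. D x k *\<^sub>R glam k"] ballI)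
qed

text \<open>The sign \<open>\<sigma>\<close> accounts for the function of the vertex opposite to the edge, which is negative.\<close>

lemma Phi_log_bounded:
  assumes ind: "l \<le> 3" "m \<le> 3" "n \<le> 3" "l \<noteq> m" "n \<noteq> l" "n \<noteq> m" and k: "k \<in> {l, m, n}"
  shows "\<exists>\<sigma> P. log_bounded P \<and> (\<forall>x\<in>Int_T. Phi (l, m, n, k) (\<lambda>j. bary v j x) = \<sigma> * P x \<and>
     P x \<le> 2 * bary v n x * bary v l x * bary v m x / ((bary v n x + bary v l x) * (bary v n x + bary v m x)))"
proof -
  let ?a = "bary v n" and ?b = "bary v l" and ?c = "bary v m"
  note lb = log_bounded_bary[OF ind(1)] log_bounded_bary[OF ind(2)] log_bounded_bary[OF ind(3)]
    log_bounded_add log_bounded_mult log_bounded_divide log_bounded_power2 log_bounded_const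
  have pos: "?a x > 0" "?b x > 0" "?c x > 0" "?b x \<le> 1" "?c x \<le> 1" if "x \<in> Int_T" for x
    using that ind by (simp_all add: bary_pos bary_le_1)
  have sum_le: "?a x + ?b x + ?c x \<le> 1" if x: "x \<in> Int_T" for x
  proof -
    have "(\<Sum>j\<in>{n, l, m}. bary v j x) \<le> (\<Sum>j\<le>3. bary v j x)"
      using ind bary_pos[OF x] by (intro sum_mono2) (auto simp: less_imp_le)
    then show ?thesis using ind by (simp add: bary_sums)
  qed
  consider "k = l" | "k = m" | "k = n" using k by blast
  then show ?thesis
  proof cases
    case 1
    show ?thesis
    proof (intro exI[of _ "1::real"] exI[of _ "\<lambda>x. ?a x * ?b x * (?c x)\<^sup>2 * (2 * ?a x + ?b x) / ((?a x + ?b x)\<^sup>2 * (?a x + ?c x))"]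
        conjI ballI)
      show "log_bounded (\<lambda>x. ?a x * ?b x * (?c x)\<^sup>2 * (2 * ?a x + ?b x) / ((?a x + ?b x)\<^sup>2 * (?a x + ?c x)))"
        by (intro lb) auto
    qed (use 1 pos in \<open>auto intro!: Phi_side_bound\<close>)
  next
    case 2
    show ?thesis
    proof (intro exI[of _ "1::real"] exI[of _ "\<lambda>x. ?a x * (?b x)\<^sup>2 * ?c x * (2 * ?a x + ?c x) / ((?a x + ?b x) * (?a x + ?c x)\<^sup>2)"]
        conjI ballI)
      show "log_bounded (\<lambda>x. ?a x * (?b x)\<^sup>2 * ?c x * (2 * ?a x + ?c x) / ((?a x + ?b x) * (?a x + ?c x)\<^sup>2))"
        by (intro lb) auto
      fix x assume "x \<in> Int_T"
      then show "?a x * (?b x)\<^sup>2 * ?c x * (2 * ?a x + ?c x) / ((?a x + ?b x) * (?a x + ?c x)\<^sup>2)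
          \<le> 2 * ?a x * ?b x * ?c x / ((?a x + ?b x) * (?a x + ?c x))"
        using Phi_side_bound[of "?a x" "?c x" "?b x"] pos by (simp add: mult_ac)
    qed (use 2 ind in auto)
  next
    case 3
    let ?s = "\<lambda>x. ?a x + ?b x + ?c x"
    let ?P = "\<lambda>x. ?a x * ?b x * ?c x * (?a x * ?b x * ?c x + 2 * ?b x * ?c x * ?s x + ?a x * ?s x * ?s x)
        / (((?a x + ?b x) * (?a x + ?c x)) * ((?a x + ?b x) * (?a x + ?c x)))"
    show ?thesis
    proof (intro exI[of _ "-1::real"] exI[of _ ?P] conjI ballI)
      show "log_bounded ?P"
        by (intro lb) auto
      fix x assume x: "x \<in> Int_T"
      show "?P x \<le> 2 * ?a x * ?b x * ?c x / ((?a x + ?b x) * (?a x + ?c x))"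
        by (rule Phi_opposite_bound) (use pos[OF x] sum_le[OF x] in auto)
      show "Phi (l, m, n, k) (\<lambda>j. bary v j x) = - 1 * ?P x"
        using Phi_opposite_eq[OF pos(1-3)[OF x]] 3 ind by simp
    qed
  qed
qed

text \<open>Write \<open>R = \<lambda>\<^sub>i \<Theta>\<^sub>i\<close>, which is at most any of the four coordinates, and let \<open>S\<close> be the bound of \<open>\<bar>Phi\<bar>\<close>, which
  is at most twice any coordinate other than \<open>\<lambda>\<^sub>i\<close>. To extract both factors \<open>\<lambda>\<^sub>k\<close> and \<open>\<lambda>\<^sub>j\<close> from \<open>R S\<close>, take
  \<open>\<lambda>\<^sub>k\<close> from \<open>R\<close> if \<open>k = i\<close>, and from \<open>S\<close> otherwise.\<close>

lemma lift_term_jet: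
  assumes i: "i \<le> 3" and t: "t \<in> face_index i" and j: "j \<le> 3" "j \<noteq> i" "bary v j p = 0"
  shows "has_bd_jet (\<lambda>x. bary v i x * Theta v i x * Phi t (\<lambda>j. bary v j x)) p 0 0"
proof -
  obtain l m n k where tt: "t = (l, m, n, k)" by (cases t)
  have ind: "l \<le> 3" "m \<le> 3" "n \<le> 3" "l \<noteq> m" "n \<noteq> l" "n \<noteq> m" "l \<noteq> i" "m \<noteq> i" "n \<noteq> i"
    and k: "k \<in> {l, m, n}"
    using t unfolding tt by (simp_all add: face_index_def)
  have all: "{i, n, l, m} = {..3}"
    by (rule card_subset_eq) (use ind i in auto)
  then have J: "{..3} - {i} = {n, l, m}" using ind by auto
  have jcases: "j \<in> {n, l, m}" using J j by auto
  let ?a = "bary v n" and ?b = "bary v l" and ?c = "bary v m" and ?d = "bary v i"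
  obtain \<sigma> P where P: "log_bounded P" "\<And>x. x \<in> Int_T \<Longrightarrow> Phi t (\<lambda>j. bary v j x) = \<sigma> * P x"
     "\<And>x. x \<in> Int_T \<Longrightarrow> P x \<le> 2 * ?a x * ?b x * ?c x / ((?a x + ?b x) * (?a x + ?c x))"
    using Phi_log_bounded[OF ind(1-6) k] unfolding tt by metis
  let ?R = "\<lambda>x. ?d x * (?a x / (?d x + ?a x) * (?b x / (?d x + ?b x) * (?c x / (?d x + ?c x))))"
  have R: "?d x * Theta v i x = ?R x" for x
    unfolding Theta_def J using ind by simp
  have lbR: "log_bounded ?R"
    by (intro log_bounded_mult log_bounded_divide log_bounded_add log_bounded_bary ind i)
  have Rpos: "?R x > 0" if "x \<in> Int_T" for x
    using bary_pos[OF that] ind i by (intro mult_pos_pos divide_pos_pos add_pos_pos) auto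
  have "has_bd_jet (\<lambda>x. ?R x * P x) p 0 0"
  proof (rule has_bd_jet_flat[where h = "\<lambda>x. 2 * bary v j x"])
    show "log_bounded (\<lambda>x. ?R x * P x)"
      by (rule log_bounded_mult[OF lbR P(1)])
    have "(bary v j \<longlongrightarrow> bary v j p) (at p within Int_T)"
      using continuous_on_bary[OF j(1), of UNIV] by (meson UNIV_I continuous_on_def subset_UNIV tendsto_within_subset)
    then show "((\<lambda>x. 2 * bary v j x) \<longlongrightarrow> 0) (at p within Int_T)"
      using j(3) tendsto_mult_right_zero by metis
  next
    fix x k' assume x: "x \<in> Int_T" and k': "k' \<le> (3::nat)"
    let ?S = "2 * ?a x * ?b x * ?c x / ((?a x + ?b x) * (?a x + ?c x))"
    have pos: "?a x > 0" "?b x > 0" "?c x > 0" "?d x > 0"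
      using bary_pos[OF x] ind i by auto
    have S: "?S \<le> 2 * bary v k x" if "k \<in> {n, l, m}" for k
      using Phi_bound_le[OF pos(1-3)] that by auto
    have Rle: "?R x \<le> bary v k x" if "k \<le> 3" for k
    proof -
      have "k \<in> {i, n, l, m}" using that all by auto
      then show ?thesis using weighted_ratio_le[OF pos] by auto
    qed
    have "?R x * P x \<le> ?R x * ?S"
      using P(3)[OF x] Rpos[OF x] by (intro mult_left_mono) auto
    also have "\<dots> \<le> bary v k' x * (2 * bary v j x)"
    proof (cases "k' = i")
      case True
      then show ?thesis
        using S[OF jcases] Rle[OF k'] pos Rpos[OF x] by (intro mult_mono) auto
    next
      case False
      then have "k' \<in> {n, l, m}" using k' J by auto
      have "?R x * ?S \<le> bary v j x * (2 * bary v k' x)"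
        using S[OF \<open>k' \<in> _\<close>] Rle[OF j(1)] pos bary_pos[OF x j(1)] Rpos[OF x] by (intro mult_mono) auto
      then show ?thesis by (simp add: mult_ac)
    qed
    finally show "?R x * P x \<le> bary v k' x * (2 * bary v j x)" .
  qed
  then have "has_bd_jet (\<lambda>x. \<sigma> * (?R x * P x)) p (\<sigma> * 0) (\<sigma> *\<^sub>R 0)"
    by (rule has_bd_jet_scale)
  moreover have "\<sigma> * (?R x * P x) = ?d x * Theta v i x * Phi t (\<lambda>j. bary v j x)" if "x \<in> Int_T" for x
    unfolding R P(2)[OF that] by simp
  ultimately show ?thesis
    using has_bd_jet_cong[of "\<lambda>x. \<sigma> * (?R x * P x)" "\<lambda>x. ?d x * Theta v i x * Phi t (\<lambda>j. bary v j x)" p 0 0]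
    by (simp del: Phi.simps)
qed

lemma normal_lift_jet:
  assumes i: "i \<le> 3" and q: "q \<in> Q_edge v i" and j: "j \<le> 3" "j \<noteq> i" "bary v j p = 0"
  shows "has_bd_jet (normal_lift v i q) p 0 0"
proof -
  obtain c where c: "bary_ext v i q = Phi_sum v i c"
    using bary_ext_Phi_sum[OF q] by blast
  have "(\<lambda>x. bary v i x / dnu v i i * Theta v i x * bary_ext v i q x)
      = (\<lambda>x. \<Sum>t\<in>face_index i. (c t / dnu v i i) * (bary v i x * Theta v i x * Phi t (\<lambda>j. bary v j x)))"
    by (simp add: c Phi_sum_def sum_distrib_left sum_divide_distrib fun_eq_iff mult_ac)
  moreover have "has_bd_jet (\<lambda>x. \<Sum>t\<in>face_index i. (c t / dnu v i i) * (bary v i x * Theta v i x * Phi t (\<lambda>j. bary v j x))) p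
     (\<Sum>t\<in>face_index i. (c t / dnu v i i) * 0) (\<Sum>t\<in>face_index i. (c t / dnu v i i) *\<^sub>R 0)"
    by (intro has_bd_jet_linear_combination lift_term_jet[OF i _ j])
  ultimately show ?thesis
    by (simp add: normal_lift_def has_bd_jet_restr)
qed

lemma R_T_jet:
  assumes z: "z \<in> Z3e v" and p: "p \<in> tet v" and edge: "\<And>i. i \<le> 3 \<Longrightarrow> \<exists>j\<le>3. j \<noteq> i \<and> bary v j p = 0"
  shows "bd_val v (R_T v z) p = bd_val v z p" "bd_grad v (R_T v z) p = bd_grad v z p"
proof -
  have "has_bd_jet (normal_lift v i (q_part v i z)) p 0 0" if "i \<in> {..3}" for i
    using edge[of i] that normal_lift_jet q_part_decomposition(1)[OF _ z] by auto
  then have "has_bd_jet (\<lambda>x. \<Sum>i\<le>3. (-1) * normal_lift v i (q_part v i z) x) p (\<Sum>i::nat\<le>3. (-1) * 0) (\<Sum>i::nat\<le>3. (-1) *\<^sub>R 0)"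
    by (rule has_bd_jet_linear_combination)
  from has_bd_jet_add[OF Z3e_jet[OF z p] this]
  have "has_bd_jet (R_T v z) p (bd_val v z p) (bd_grad v z p)"
    by (simp add: R_T_def fun_diff_def sum_fun_apply sum_negf)
  then show "bd_val v (R_T v z) p = bd_val v z p" "bd_grad v (R_T v z) p = bd_grad v z p"
    using bd_val_eq bd_grad_eq p by blast+
qed

end

section \<open>Coordinate vectors and dimension\<close>

lemma of_nat_28_eq_0: "(of_nat n :: 28) = 0 \<longleftrightarrow> 28 dvd n"
  by (simp add: of_nat_eq_0_iff_char_dvd)

text \<open>\<^term>\<open>vector\<close> enumerates its list from the index \<open>1\<close>; in a list of \<open>28\<close> entries the last one gets the index
  \<open>28 = 0\<close>, so that no index is used twice.\<close>

lemma foldr_vector_nth: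
  fixes a :: 28 and l :: "real list"
  assumes "k < length l" "length l \<le> 28"
  shows "foldr (\<lambda>x f n. (f (n + 1))(n := x)) l (\<lambda>n x. 0) a (a + of_nat k) = l ! k"
  using assms
proof (induction l arbitrary: a k)
  case (Cons x xs)
  show ?case
  proof (cases k)
    case (Suc k')
    have "(of_nat k :: 28) \<noteq> 0"
      using Cons.prems Suc unfolding of_nat_28_eq_0 by (auto dest: dvd_imp_le)
    then show ?thesis
      using Cons.IH[of k' "a + 1"] Cons.prems Suc by (simp add: add.assoc)
  qed simp
qed simp

lemma vector_nth_28:
  assumes "length (l :: real list) = 28" "k < 28"
  shows "(vector l :: real^28) $ (of_nat (Suc k)) = l ! k"
  using foldr_vector_nth[of k l 1] assms by (simp add: vector_def)

lemma indices_28: "(UNIV :: 28 set) = (\<lambda>k. of_nat (Suc k)) ` {..<28}"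
proof -
  let ?f = "\<lambda>k. of_nat (Suc k) :: 28"
  have "inj_on ?f {..<28}"
  proof (rule linorder_inj_onI)
    fix j k :: nat assume jk: "j < k" "j \<in> {..<28}" "k \<in> {..<28}"
    have "of_nat (k - j) \<noteq> (0::28)"
      unfolding of_nat_28_eq_0 using jk by (auto dest: dvd_imp_le)
    then show "?f j \<noteq> ?f k"
      using jk by (simp add: of_nat_diff)
  qed auto
  then have "card (?f ` {..<28}) = CARD(28)"
    by (simp add: card_image)
  then show ?thesis
    by (metis card_subset_eq finite subset_UNIV)
qed

lemma vec_28_eqI:
  fixes x y :: "real^28"
  assumes "\<And>k. k < 28 \<Longrightarrow> x $ of_nat (Suc k) = y $ of_nat (Suc k)"
  shows "x = y"
proof -
  have "x $ i = y $ i" for i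
  proof -
    have "i \<in> (\<lambda>k. of_nat (Suc k)) ` {..<28}" using indices_28 by blast
    then show ?thesis using assms by auto
  qed
  then show ?thesis by (simp add: vec_eq_iff)
qed

lemma vector_28_inject:
  assumes "length (l :: real list) = 28" "length l' = 28" "(vector l :: real^28) = vector l'"
  shows "l = l'"
  using vector_nth_28[OF assms(1)] vector_nth_28[OF assms(2)] assms
  by (intro nth_equalityI) auto

lemma vector_28_surj: "\<exists>l :: real list. length l = 28 \<and> vector l = (y :: real^28)"
proof (intro exI conjI)
  let ?l = "map (\<lambda>k. y $ of_nat (Suc k)) [0..<28]"
  show "length ?l = 28" by simp
  then show "vector ?l = y"
    using vector_nth_28[of ?l] by (intro vec_28_eqI) simp
qed

lemma vector_28_linear:
  assumes "length (l :: real list) = 28" "length l' = 28"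
  shows "a *\<^sub>R (vector l :: real^28) + b *\<^sub>R vector l' = vector (map2 (\<lambda>p q. a * p + b * q) l l')"
  using assms by (intro vec_28_eqI) (simp del: of_nat_Suc add: vector_nth_28)

text \<open>Only the target is a Euclidean space; a basis of \<open>S\<close> is obtained by pulling back the standard basis
  with the inverse of \<open>D\<close>.\<close>

lemma dim_linear_bij:
  fixes D :: "'a::real_vector \<Rightarrow> 'b::euclidean_space"
  assumes S: "subspace S"
    and lin: "\<And>z w a b. z \<in> S \<Longrightarrow> w \<in> S \<Longrightarrow> D (a *\<^sub>R z + b *\<^sub>R w) = a *\<^sub>R D z + b *\<^sub>R D w"
    and bij: "bij_betw D S UNIV"
  shows "dim S = DIM('b)"
proof -
  define T where "T = inv_into S D"
  have TS: "T y \<in> S" and DT: "D (T y) = y" for y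
    using bij unfolding T_def bij_betw_def by (auto intro: inv_into_into f_inv_into_f)
  have TD: "T (D z) = z" if "z \<in> S" for z
    using bij that unfolding T_def bij_betw_def by simp
  have T_lin: "T (a *\<^sub>R x + b *\<^sub>R y) = a *\<^sub>R T x + b *\<^sub>R T y" for a b x y
  proof -
    have "a *\<^sub>R T x + b *\<^sub>R T y \<in> S"
      using TS S by (intro subspace_add subspace_scale)
    then show ?thesis
      using TD lin[OF TS TS] DT by metis
  qed
  have "linear T"
    using T_lin[of 1 _ 1] T_lin[of _ _ 0 0] by (intro linearI) auto
  have "inj T"
    using DT by (metis injI)
  have "T ` UNIV = S"
    using TS TD by (auto simp: image_def) metis
  then have "span (T ` Basis) = S"
    using linear_span_image[OF \<open>linear T\<close>, of Basis] by simp
  moreover have "independent (T ` Basis)"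
    using linear_independent_injective_image[OF \<open>linear T\<close> independent_Basis] \<open>inj T\<close>
    by simp
  ultimately have "dim S = card (T ` Basis)"
    using dim_eq_card[of "T ` Basis" S] span_eq_iff S by metis
  then show ?thesis
    using \<open>inj T\<close> by (metis card_image inj_on_subset subset_UNIV)
qed

context tetrahedron
begin

section \<open>The two unknowns of an edge\<close>

text \<open>The combination \<open>w\<close> is perpendicular to the edge, hence in the span of the two test vectors, and
  therefore perpendicular to itself.\<close>

lemma edge_combination_eq_0:
  assumes lm: "l < m" "m \<le> 3"
    and perp: "\<gamma>0 \<in> edge_perp v l m" "\<gamma>1 \<in> edge_perp v l m"
    and indep: "\<gamma>0 \<noteq> \<gamma>1" "independent {\<gamma>0, \<gamma>1}"
    and zero: "(\<Sum>n\<in>{..3} - {l, m}. c n *\<^sub>R glam n) \<bullet> \<gamma>0 = 0" "(\<Sum>n\<in>{..3} - {l, m}. c n *\<^sub>R glam n) \<bullet> \<gamma>1 = 0"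
    and n: "n \<in> {..3} - {l, m}"
  shows "c n = 0"
proof -
  define w where "w = (\<Sum>n\<in>{..3} - {l, m}. c n *\<^sub>R glam n)"
  have edge: "w \<bullet> (v m - v l) = 0"
    unfolding w_def inner_sum_left
    by (rule sum.neutral) (use lm in \<open>auto simp: inner_commute[of "glam _"] glam_diff_vertex\<close>)
  have "v m \<noteq> v l"
    using inj_onD[OF inj_v, of m l] lm by auto
  then have "dim {x. (v m - v l) \<bullet> x = 0} = 2"
    by (subst dim_hyperplane) auto
  then have "{x. (v m - v l) \<bullet> x = 0} \<subseteq> span {\<gamma>0, \<gamma>1}"
    using perp indep by (intro card_ge_dim_independent) (auto simp: edge_perp_def orthogonal_def inner_commute)
  then have "w \<in> span {\<gamma>0, \<gamma>1}"
    using edge by (auto simp: inner_commute)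
  moreover have "orthogonal w x" if "x \<in> {\<gamma>0, \<gamma>1}" for x
    using zero that by (auto simp: w_def orthogonal_def)
  ultimately have "orthogonal w w"
    using orthogonal_to_span by blast
  then have "w = 0" by (simp add: orthogonal_def)
  have "c n = (v n - v l) \<bullet> w"
  proof -
    have "(v n - v l) \<bullet> w = (\<Sum>k\<in>{..3} - {l, m}. if k = n then c k else 0)"
      unfolding w_def inner_sum_right
      by (rule sum.cong) (use n lm in \<open>auto simp: glam_diff_vertex\<close>)
    then show ?thesis using n by simp
  qed
  then show ?thesis using \<open>w = 0\<close> by simp
qed

text \<open>Two linear equations in two unknowns, whose homogeneous version has only the trivial solution.\<close>

lemma edge_combination_exists:
  assumes lm: "l < m" "m \<le> 3"
    and perp: "\<gamma>0 \<in> edge_perp v l m" "\<gamma>1 \<in> edge_perp v l m"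
    and indep: "\<gamma>0 \<noteq> \<gamma>1" "independent {\<gamma>0, \<gamma>1}"
  shows "\<exists>c. (\<Sum>n\<in>{..3} - {l, m}. c n *\<^sub>R glam n) \<bullet> \<gamma>0 = r0 \<and> (\<Sum>n\<in>{..3} - {l, m}. c n *\<^sub>R glam n) \<bullet> \<gamma>1 = r1"
proof -
  have "card ({..3} - {l, m}) = 2"
    using lm by (subst card_Diff_subset) auto
  then obtain n1 n2 where n: "{..3} - {l, m} = {n1, n2}" "n1 \<noteq> n2"
    by (auto simp: card_2_iff)
  define f where "f p = (let w = fst p *\<^sub>R glam n1 + snd p *\<^sub>R glam n2 in (w \<bullet> \<gamma>0, w \<bullet> \<gamma>1))" for p :: "real \<times> real"
  have sum: "(\<Sum>n\<in>{..3} - {l, m}. (if n = n1 then a else b) *\<^sub>R glam n) = a *\<^sub>R glam n1 + b *\<^sub>R glam n2" for a b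
    using n by auto
  have "linear f"
    by (intro linearI) (auto simp: f_def Let_def algebra_simps inner_add_left)
  moreover have "inj f"
    unfolding linear_injective_0[OF \<open>linear f\<close>]
  proof (intro allI impI)
    fix p assume "f p = 0"
    then have *: "(\<Sum>n\<in>{..3} - {l, m}. (if n = n1 then fst p else snd p) *\<^sub>R glam n) \<bullet> \<gamma>0 = 0"
       "(\<Sum>n\<in>{..3} - {l, m}. (if n = n1 then fst p else snd p) *\<^sub>R glam n) \<bullet> \<gamma>1 = 0"
      unfolding sum by (auto simp: f_def Let_def zero_prod_def)
    have "fst p = 0" "snd p = 0"
      using edge_combination_eq_0[OF assms *, of n1] edge_combination_eq_0[OF assms *, of n2] n by auto
    then show "p = 0" by (simp add: prod_eq_iff)
  qed
  ultimately have "surj f"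
    by (rule linear_inj_imp_surj)
  then obtain p where "f p = (r0, r1)" by (metis surjD)
  then show ?thesis
    by (intro exI[of _ "\<lambda>n. if n = n1 then fst p else snd p"]) (auto simp: sum f_def Let_def)
qed

section \<open>Degrees of freedom of the enriched functions\<close>

lemma bubble_index_iff: "(l, m, n) \<in> bubble_index \<longleftrightarrow> l < m \<and> m \<le> 3 \<and> n \<le> 3 \<and> n \<noteq> l \<and> n \<noteq> m"
  by (auto simp: bubble_index_def)

lemma enriched_vertex:
  assumes "k \<le> 3"
  shows "enriched \<alpha> \<beta> \<kappa> (v k) = \<alpha> (k, k)"
proof -
  have "skew_cubic t (v k) = 0" if "t \<in> cubic_index" for t
    using that assms by (auto simp: cubic_index_def skew_cubic_def bary_vertex)
  moreover have "bubble t (v k) = 0" if "t \<in> bubble_index" for t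
    using that assms by (cases t) (auto simp: bubble_index_iff bubble_def edge_bubble_def bary_vertex)
  ultimately show ?thesis
    using assms by (simp add: enriched_def quad_form_vertex)
qed

lemma bubble_grad_vertex:
  assumes "t \<in> bubble_index" "k \<le> 3"
  shows "bubble_grad t (v k) = 0"
proof -
  obtain l m n where t: "t = (l, m, n)" by (cases t)
  have *: "l < m" "m \<le> 3" "n \<le> 3" "n \<noteq> l" "n \<noteq> m"
    using assms(1) by (simp_all add: t bubble_index_iff)
  have "bary v l (v k) = 0 \<or> bary v m (v k) = 0"
    using * assms(2) by (simp add: bary_vertex)
  then show ?thesis
    unfolding bubble_grad_def t case_prod_conv
    by (subst (1 2 3) Phi_eq_0) auto
qed

lemma bubble_grad_midpoint:
  assumes "t \<in> bubble_index" "l < m" "m \<le> 3"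
  shows "bubble_grad t (midpoint (v l) (v m)) = (if fst t = l \<and> fst (snd t) = m then (1/4) *\<^sub>R glam (snd (snd t)) else 0)"
proof -
  obtain l' m' n where t: "t = (l', m', n)" by (cases t)
  have *: "l' < m'" "m' \<le> 3" "n \<le> 3" "n \<noteq> l'" "n \<noteq> m'"
    using assms(1) by (simp_all add: t bubble_index_iff)
  have b: "bary v k (midpoint (v l) (v m)) = (if k = l \<or> k = m then 1/2 else 0)" if "k \<le> 3" for k
    using that assms by (simp add: bary_midpoint bary_vertex)
  have "bary v l' (midpoint (v l) (v m)) = 0 \<or> bary v m' (midpoint (v l) (v m)) = 0 \<or> bary v n (midpoint (v l) (v m)) = 0"
    using * by (auto simp: b)
  then have "bubble_grad t (midpoint (v l) (v m))
      = (bary v l' (midpoint (v l) (v m)) * bary v m' (midpoint (v l) (v m))) *\<^sub>R glam n"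
    unfolding bubble_grad_def t case_prod_conv
    by (subst (1 2 3) Phi_eq_0) auto
  then show ?thesis
    using * assms(2,3) by (auto simp: t b)
qed

text \<open>The derivative at \<open>v\<^sub>k\<close> along the edge to \<open>v\<^sub>m\<close>. Exchanging the ends of the edge changes the sign of the
  cubic contribution only, which is why the two end derivatives separate the two coefficients of
  the edge.\<close>

lemma enriched_grad_vertex:
  assumes "k \<le> 3" "m \<le> 3" "k \<noteq> m"
  shows "(v m - v k) \<bullet> enriched_grad \<alpha> \<beta> \<kappa> (v k)
    = \<alpha> (min k m, max k m) - 2 * \<alpha> (k, k) + (if k < m then \<beta> (k, m) else - \<beta> (m, k))"
proof -
  have "(v m - v k) \<bullet> quad_grad t (v k) = (if t = (min k m, max k m) then 1 else 0) + (if t = (k, k) then -2 else 0)"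
    if "t \<in> quad_index" for t
  proof -
    obtain i j where t: "t = (i, j)" by (cases t)
    have ij: "i \<le> j" "j \<le> 3" using that by (simp_all add: t quad_index_def)
    have "(v m - v k) \<bullet> quad_grad t (v k) = (if i = k then (if j = m then 1 else 0) - (if j = k then 1 else 0) else 0)
      + (if j = k then (if i = m then 1 else 0) - (if i = k then 1 else 0) else 0)"
      using ij assms by (simp add: t quad_grad_def inner_add_right bary_vertex glam_diff_vertex)
    then show ?thesis
      using ij assms(3) by (auto simp: t min_def max_def)
  qed
  then have "(v m - v k) \<bullet> (\<Sum>t\<in>quad_index. \<alpha> t *\<^sub>R quad_grad t (v k))
     = (\<Sum>t\<in>quad_index. (if t = (min k m, max k m) then \<alpha> t else 0) + (if t = (k, k) then -2 * \<alpha> t else 0))"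
    unfolding inner_sum_right by (intro sum.cong) auto
  also have "\<dots> = \<alpha> (min k m, max k m) - 2 * \<alpha> (k, k)"
    using assms finite_quad_index by (simp add: sum.distrib quad_index_def)
  finally have Q: "(v m - v k) \<bullet> (\<Sum>t\<in>quad_index. \<alpha> t *\<^sub>R quad_grad t (v k)) = \<alpha> (min k m, max k m) - 2 * \<alpha> (k, k)" .
  have cubic: "(v m - v k) \<bullet> cubic_grad t (v k) = (if t = (k, m) then 1 else 0) - (if t = (m, k) then 1 else 0)"
    if "t \<in> cubic_index" for t
  proof -
    obtain i j where t: "t = (i, j)" by (cases t)
    have ij: "i < j" "j \<le> 3" using that by (simp_all add: t cubic_index_def)
    have "2 * bary v i (v k) * bary v j (v k) = 0"
      using ij assms by (simp add: bary_vertex)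
    then have "cubic_grad t (v k) = (- (bary v j (v k))\<^sup>2) *\<^sub>R glam i + (bary v i (v k))\<^sup>2 *\<^sub>R glam j"
      unfolding t cubic_grad_def case_prod_conv by (simp only: diff_0 diff_0_right)
    then show ?thesis
      using ij assms by (auto simp: t inner_add_right bary_vertex glam_diff_vertex)
  qed
  have "(v m - v k) \<bullet> (\<Sum>t\<in>cubic_index. \<beta> t *\<^sub>R cubic_grad t (v k))
     = (\<Sum>t\<in>cubic_index. (if t = (k, m) then \<beta> t else 0) - (if t = (m, k) then \<beta> t else 0))"
    unfolding inner_sum_right inner_scaleR_right
  proof (rule sum.cong[OF refl])
    fix t assume t: "t \<in> cubic_index"
    show "\<beta> t * ((v m - v k) \<bullet> cubic_grad t (v k)) = (if t = (k, m) then \<beta> t else 0) - (if t = (m, k) then \<beta> t else 0)"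
      unfolding cubic[OF t] using assms(3) by (cases "t = (k, m)") simp_all
  qed
  also have "\<dots> = (if k < m then \<beta> (k, m) else - \<beta> (m, k))"
    using assms finite_cubic_index by (auto simp: sum_subtractf cubic_index_def)
  finally have C: "(v m - v k) \<bullet> (\<Sum>t\<in>cubic_index. \<beta> t *\<^sub>R cubic_grad t (v k)) = (if k < m then \<beta> (k, m) else - \<beta> (m, k))" .
  show ?thesis
    unfolding enriched_grad_def inner_add_right Q C
    using bubble_grad_vertex[OF _ assms(1)] by simp
qed

lemma enriched_grad_midpoint:
  assumes "l < m" "m \<le> 3"
  shows "4 *\<^sub>R enriched_grad \<alpha> \<beta> \<kappa> (midpoint (v l) (v m))
    = 4 *\<^sub>R enriched_grad \<alpha> \<beta> (\<lambda>_. 0) (midpoint (v l) (v m)) + (\<Sum>n\<in>{..3} - {l, m}. \<kappa> (l, m, n) *\<^sub>R glam n)"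
proof -
  have "(\<Sum>t\<in>bubble_index. \<kappa> t *\<^sub>R bubble_grad t (midpoint (v l) (v m)))
     = (\<Sum>t\<in>(\<lambda>n. (l, m, n)) ` ({..3} - {l, m}). \<kappa> t *\<^sub>R bubble_grad t (midpoint (v l) (v m)))"
    by (rule sum.mono_neutral_right)
      (use assms in \<open>auto simp: finite_bubble_index bubble_index_iff bubble_grad_midpoint\<close>)
  also have "\<dots> = (\<Sum>n\<in>{..3} - {l, m}. \<kappa> (l, m, n) *\<^sub>R bubble_grad (l, m, n) (midpoint (v l) (v m)))"
    by (subst sum.reindex) (auto simp: inj_on_def)
  also have "\<dots> = (\<Sum>n\<in>{..3} - {l, m}. (1/4) *\<^sub>R (\<kappa> (l, m, n) *\<^sub>R glam n))"
    using assms by (intro sum.cong) (auto simp: bubble_grad_midpoint bubble_index_iff)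
  finally show ?thesis
    by (simp add: enriched_grad_def scaleR_add_right scaleR_sum_right)
qed

end

section \<open>Unisolvence\<close>

text \<open>The entries of \<^term>\<open>dofs\<close> before they are packed into a vector.\<close>

definition dof_list :: "(nat \<Rightarrow> real^3) \<Rightarrow> (nat \<Rightarrow> nat \<Rightarrow> nat \<Rightarrow> real^3) \<Rightarrow> (real^3 \<Rightarrow> real) \<Rightarrow> real list"
  where "dof_list v \<gamma> z = concat (map (vertex_dofs v z) [0, 1, 2, 3]) @
     concat (map (\<lambda>(l, m). [edge_dof v \<gamma> z l m 0, edge_dof v \<gamma> z l m 1])
       [(0, 1), (0, 2), (0, 3), (1, 2), (1, 3), (2, 3)])"

lemma length_dof_list: "length (dof_list v \<gamma> z) = 28"
  by (simp add: dof_list_def vertex_dofs_def)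

lemma dofs_eq_vector: "dofs v \<gamma> z = vector (dof_list v \<gamma> z)"
  by (simp add: dofs_def dof_list_def)

lemma edge_cases:
  assumes "l < m" "m \<le> (3::nat)"
  shows "(l, m) \<in> {(0, 1), (0, 2), (0, 3), (1, 2), (1, 3), (2, 3)}"
proof -
  have "m = 1 \<or> m = 2 \<or> m = 3" "l = 0 \<or> l = 1 \<or> l = 2" using assms by linarith+
  then show ?thesis using assms by (elim disjE) simp_all
qed

lemma vertex_cases:
  assumes "k \<le> (3::nat)"
  shows "k = 0 \<or> k = 1 \<or> k = 2 \<or> k = 3"
  using assms by linarith

lemma dofs_eq_iff:
  "dofs v \<gamma> z = dofs v \<gamma> w \<longleftrightarrow>
    (\<forall>k\<le>3. bd_val v z (v k) = bd_val v w (v k) \<and> bd_grad v z (v k) = bd_grad v w (v k)) \<and>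
    (\<forall>l m j. l < m \<longrightarrow> m \<le> 3 \<longrightarrow> j \<le> 1 \<longrightarrow> edge_dof v \<gamma> z l m j = edge_dof v \<gamma> w l m j)" (is "?L = ?R")
proof
  assume ?L
  then have eq: "dof_list v \<gamma> z = dof_list v \<gamma> w"
    using vector_28_inject[OF length_dof_list length_dof_list] by (simp add: dofs_eq_vector)
  have "bd_val v z (v k) = bd_val v w (v k) \<and> bd_grad v z (v k) = bd_grad v w (v k)" if "k \<le> 3" for k
    using vertex_cases[OF that] eq
    by (elim disjE) (simp_all add: dof_list_def vertex_dofs_def vec_eq_iff forall_3)
  moreover have "edge_dof v \<gamma> z l m j = edge_dof v \<gamma> w l m j" if "l < m" "m \<le> 3" "j \<le> 1" for l m j
  proof -
    have "j = 0 \<or> j = 1" using that by linarith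
    then show ?thesis
      using edge_cases[OF that(1,2)] eq unfolding dof_list_def vertex_dofs_def by auto
  qed
  ultimately show ?R by blast
next
  assume ?R
  then have "dof_list v \<gamma> z = dof_list v \<gamma> w"
    by (simp add: dof_list_def vertex_dofs_def)
  then show ?L by (simp add: dofs_eq_vector)
qed

text \<open>Reads off from a vector the vertex values \<open>f\<close>, vertex gradients \<open>G\<close> and edge data \<open>s\<close> that it encodes.\<close>

lemma target_data:
  fixes y :: "real^28"
  obtains f G s where "\<And>z. (\<And>k. k \<le> 3 \<Longrightarrow> bd_val v z (v k) = f k \<and> bd_grad v z (v k) = G k) \<Longrightarrow>
     (\<And>l m j. l < m \<Longrightarrow> m \<le> 3 \<Longrightarrow> j \<le> 1 \<Longrightarrow> edge_dof v \<gamma> z l m j = s l m j) \<Longrightarrow> dofs v \<gamma> z = y"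
proof -
  obtain L :: "real list" where L: "length L = 28" "vector L = y"
    using vector_28_surj by blast
  define f where "f k = L ! (4 * k)" for k
  define G where "G k = (vector [L ! (4 * k + 1), L ! (4 * k + 2), L ! (4 * k + 3)] :: real^3)" for k
  \<comment> \<open>The position of the first entry of the edge: the edges come in lexicographic order from position \<open>16\<close> on.\<close>
  define e where "e l m = (if l = 0 then 14 + 2 * m else if l = 1 then 18 + 2 * m else 20 + 2 * m)" for l m :: nat
  define s where "s l m j = L ! (e l m + j)" for l m j
  show thesis
  proof (rule that[of f G s])
    fix z
    assume vert: "\<And>k. k \<le> 3 \<Longrightarrow> bd_val v z (v k) = f k \<and> bd_grad v z (v k) = G k"
      and edge: "\<And>l m j. l < m \<Longrightarrow> m \<le> 3 \<Longrightarrow> j \<le> 1 \<Longrightarrow> edge_dof v \<gamma> z l m j = s l m j"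
    have "dof_list v \<gamma> z = map (nth L) [0..<28]"
      unfolding dof_list_def vertex_dofs_def
      by (simp add: vert edge f_def G_def s_def e_def upt_rec[of _ "28"], simp add: eval_nat_numeral)
    also have "\<dots> = L" using L(1) map_nth[of L] by simp
    finally show "dofs v \<gamma> z = y" using L(2) by (simp add: dofs_eq_vector)
  qed
qed

context tetrahedron
begin

text \<open>The edge vectors at a vertex span the space.\<close>

lemma eq_0_if_orthogonal_to_edges:
  assumes "k \<le> 3" "\<And>m. m \<le> 3 \<Longrightarrow> m \<noteq> k \<Longrightarrow> (v m - v k) \<bullet> w = 0"
  shows "w = 0"
proof -
  have "(\<Sum>m\<le>3. bary v m (v k + w) *\<^sub>R (v m - v k)) = w"
    by (simp add: scaleR_diff_right sum_subtractf bary_sums flip: scaleR_sum_left)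
  then have "w \<bullet> w = (\<Sum>m\<le>3. bary v m (v k + w) *\<^sub>R (v m - v k)) \<bullet> w"
    by simp
  also have "\<dots> = 0"
    unfolding inner_sum_left
  proof (rule sum.neutral, rule)
    fix m assume "m \<in> {..(3::nat)}"
    then show "bary v m (v k + w) *\<^sub>R (v m - v k) \<bullet> w = 0"
      using assms(2)[of m] by (cases "m = k") auto
  qed
  finally show ?thesis by simp
qed

lemma bd_vertex:
  assumes "k \<le> 3"
  shows "bd_val v (restr Int_T (enriched \<alpha> \<beta> \<kappa>)) (v k) = \<alpha> (k, k)"
    and "bd_grad v (restr Int_T (enriched \<alpha> \<beta> \<kappa>)) (v k) = enriched_grad \<alpha> \<beta> \<kappa> (v k)"
  using has_bd_jet_enriched[OF vertex_in_tet[OF assms], of \<alpha> \<beta> \<kappa>]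
    bd_val_eq[OF _ vertex_in_tet[OF assms]] bd_grad_eq[OF _ vertex_in_tet[OF assms]] enriched_vertex[OF assms]
  by simp_all

lemma edge_dof_enriched:
  assumes "l < m" "m \<le> 3"
  shows "edge_dof v \<gamma> (restr Int_T (enriched \<alpha> \<beta> \<kappa>)) l m j
    = 4 * (enriched_grad \<alpha> \<beta> (\<lambda>_. 0) (midpoint (v l) (v m)) \<bullet> \<gamma> l m j)
      + (\<Sum>n\<in>{..3} - {l, m}. \<kappa> (l, m, n) *\<^sub>R glam n) \<bullet> \<gamma> l m j"
proof -
  have p: "midpoint (v l) (v m) \<in> tet v" using assms by (intro midpoint_in_tet) auto
  have "edge_dof v \<gamma> (restr Int_T (enriched \<alpha> \<beta> \<kappa>)) l m j
      = (4 *\<^sub>R enriched_grad \<alpha> \<beta> \<kappa> (midpoint (v l) (v m))) \<bullet> \<gamma> l m j"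
    by (simp add: edge_dof_def bd_grad_eq[OF has_bd_jet_enriched[OF p] p])
  then show ?thesis
    unfolding enriched_grad_midpoint[OF assms, of \<alpha> \<beta> \<kappa>] by (simp add: inner_add_left)
qed

end

locale tetrahedron_with_edge_normals = tetrahedron +
  fixes \<gamma> :: "nat \<Rightarrow> nat \<Rightarrow> nat \<Rightarrow> real^3"
  assumes perp: "\<And>l m j. l < m \<Longrightarrow> m \<le> 3 \<Longrightarrow> j \<le> 1 \<Longrightarrow> \<gamma> l m j \<in> edge_perp v l m"
    and indep: "\<And>l m. l < m \<Longrightarrow> m \<le> 3 \<Longrightarrow> \<gamma> l m 0 \<noteq> \<gamma> l m 1 \<and> independent {\<gamma> l m 0, \<gamma> l m 1}"
begin

lemma dofs_linear_Z3e:
  assumes "z \<in> Z3e v" "w \<in> Z3e v"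
  shows "dofs v \<gamma> (a *\<^sub>R z + b *\<^sub>R w) = a *\<^sub>R dofs v \<gamma> z + b *\<^sub>R dofs v \<gamma> w"
proof -
  have "bd_val v (a *\<^sub>R z + b *\<^sub>R w) (v k) = a * bd_val v z (v k) + b * bd_val v w (v k)"
     "bd_grad v (a *\<^sub>R z + b *\<^sub>R w) (v k) = a *\<^sub>R bd_grad v z (v k) + b *\<^sub>R bd_grad v w (v k)" if "k \<le> 3" for k
    using jet_linear_Z3e[OF assms vertex_in_tet[OF that]] by blast+
  moreover have "edge_dof v \<gamma> (a *\<^sub>R z + b *\<^sub>R w) l m j = a * edge_dof v \<gamma> z l m j + b * edge_dof v \<gamma> w l m j"
    if "l \<le> 3" "m \<le> 3" for l m j
    using jet_linear_Z3e(2)[OF assms midpoint_in_tet[OF that]]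
    by (simp add: edge_dof_def inner_add_left algebra_simps)
  ultimately have "dof_list v \<gamma> (a *\<^sub>R z + b *\<^sub>R w) = map2 (\<lambda>p q. a * p + b * q) (dof_list v \<gamma> z) (dof_list v \<gamma> w)"
    unfolding dof_list_def vertex_dofs_def by simp
  then show ?thesis
    using vector_28_linear[OF length_dof_list length_dof_list] by (simp add: dofs_eq_vector)
qed

text \<open>The coefficients can be recovered one family after the other: squares from the vertex values, the
  other quadratics and the cubics from the vertex gradients, and the bubbles from the edge data.\<close>

lemma enriched_dofs_eq_0:
  assumes z: "z = restr Int_T (enriched \<alpha> \<beta> \<kappa>)"
    and val: "\<And>k. k \<le> 3 \<Longrightarrow> bd_val v z (v k) = 0" and grad: "\<And>k. k \<le> 3 \<Longrightarrow> bd_grad v z (v k) = 0"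
    and edge: "\<And>l m j. l < m \<Longrightarrow> m \<le> 3 \<Longrightarrow> j \<le> 1 \<Longrightarrow> edge_dof v \<gamma> z l m j = 0"
  shows "z = 0"
proof -
  have diag: "\<alpha> (k, k) = 0" if "k \<le> 3" for k
    using val[OF that] bd_vertex(1)[OF that] by (simp add: z)
  have "\<alpha> (i, j) + \<beta> (i, j) = 0 \<and> \<alpha> (i, j) - \<beta> (i, j) = 0" if "i < j" "j \<le> 3" for i j
  proof -
    have "i \<le> 3" using that by simp
    have "enriched_grad \<alpha> \<beta> \<kappa> (v i) = 0" "enriched_grad \<alpha> \<beta> \<kappa> (v j) = 0"
      using grad[OF \<open>i \<le> 3\<close>] grad[OF \<open>j \<le> 3\<close>] bd_vertex(2)[OF \<open>i \<le> 3\<close>] bd_vertex(2)[OF \<open>j \<le> 3\<close>] by (simp_all add: z)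
    then show ?thesis
      using enriched_grad_vertex[of i j \<alpha> \<beta> \<kappa>] enriched_grad_vertex[of j i \<alpha> \<beta> \<kappa>] that diag \<open>i \<le> 3\<close>
      by (simp add: min_def max_def)
  qed
  then have off: "\<alpha> (i, j) = 0" "\<beta> (i, j) = 0" if "i < j" "j \<le> 3" for i j
    using that by fastforce+
  have \<alpha>: "\<alpha> t = 0" if "t \<in> quad_index" for t
    using that diag off by (cases t) (auto simp: quad_index_def le_less)
  have \<beta>: "\<beta> t = 0" if "t \<in> cubic_index" for t
    using that off by (cases t) (auto simp: cubic_index_def)
  have "enriched_grad \<alpha> \<beta> (\<lambda>_. 0) x = 0" for x
    unfolding enriched_grad_def by (simp add: \<alpha> \<beta>)
  then have edge_sum: "(\<Sum>n\<in>{..3} - {l, m}. \<kappa> (l, m, n) *\<^sub>R glam n) \<bullet> \<gamma> l m j = 0"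
    if "l < m" "m \<le> 3" "j \<le> 1" for l m j
    using edge[OF that] edge_dof_enriched[OF that(1,2), of \<gamma> \<alpha> \<beta> \<kappa> j] by (simp add: z)
  have \<kappa>: "\<kappa> t = 0" if "t \<in> bubble_index" for t
  proof -
    obtain l m n where t: "t = (l, m, n)" by (cases t)
    have lm: "l < m" "m \<le> 3" "n \<in> {..3} - {l, m}"
      using that by (auto simp: t bubble_index_def)
    show ?thesis
      unfolding t
      by (rule edge_combination_eq_0[OF lm(1,2) perp perp _ _ edge_sum edge_sum lm(3), of 0 1])
        (use lm indep in auto)
  qed
  show ?thesis
    unfolding z by (auto simp: enriched_def restr_def fun_eq_iff zero_fun_def \<alpha> \<beta> \<kappa>)
qed

lemma dofs_inj_on_Z3e: "inj_on (dofs v \<gamma>) (Z3e v)"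
proof (rule inj_onI)
  fix z w assume zw: "z \<in> Z3e v" "w \<in> Z3e v" and eq: "dofs v \<gamma> z = dofs v \<gamma> w"
  define d where "d = 1 *\<^sub>R z + (-1) *\<^sub>R w"
  have d: "d \<in> Z3e v"
    unfolding d_def using zw by (intro subspace_add subspace_scale subspace_Z3e)
  have vert: "bd_val v d (v k) = 0 \<and> bd_grad v d (v k) = 0" if "k \<le> 3" for k
    using eq that jet_linear_Z3e[OF zw vertex_in_tet[OF that], of 1 "-1"] unfolding dofs_eq_iff d_def by simp
  have edge: "edge_dof v \<gamma> d l m j = 0" if lm: "l < m" "m \<le> 3" "j \<le> 1" for l m j
  proof -
    have "midpoint (v l) (v m) \<in> tet v" using lm by (intro midpoint_in_tet) auto
    moreover have "edge_dof v \<gamma> z l m j = edge_dof v \<gamma> w l m j"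
      using eq lm unfolding dofs_eq_iff by blast
    ultimately show ?thesis
      using jet_linear_Z3e(2)[OF zw, of "midpoint (v l) (v m)" 1 "-1"]
      by (simp add: edge_dof_def d_def inner_diff_left)
  qed
  obtain \<alpha> \<beta> \<kappa> where "d = restr Int_T (enriched \<alpha> \<beta> \<kappa>)"
    using d by (auto simp: Z3e_eq)
  then have "d = 0"
    by (rule enriched_dofs_eq_0) (use vert edge in auto)
  then show "z = w" by (simp add: d_def)
qed

text \<open>The same order of elimination solves for arbitrary data; the contribution of the polynomial part to
  the edge data is moved to the right-hand side \<open>r\<close>.\<close>

lemma dofs_surj_on_Z3e: "\<exists>z\<in>Z3e v. dofs v \<gamma> z = y"
proof -
  obtain f G s where target: "\<And>z. (\<And>k. k \<le> 3 \<Longrightarrow> bd_val v z (v k) = f k \<and> bd_grad v z (v k) = G k) \<Longrightarrow>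
     (\<And>l m j. l < m \<Longrightarrow> m \<le> 3 \<Longrightarrow> j \<le> 1 \<Longrightarrow> edge_dof v \<gamma> z l m j = s l m j) \<Longrightarrow> dofs v \<gamma> z = y"
    using target_data[of v \<gamma> y] by blast
  \<comment> \<open>\<open>P i j\<close> is what the sum \<open>\<alpha> + \<beta>\<close> of the coefficients of the edge must be when seen from \<open>v\<^sub>i\<close>.\<close>
  define P where "P i j = (v j - v i) \<bullet> G i + 2 * f i" for i j
  define \<alpha> where "\<alpha> t = (case t of (i, j) \<Rightarrow> if i = j then f i else (P i j + P j i) / 2)" for t
  define \<beta> where "\<beta> t = (case t of (i, j) \<Rightarrow> (P i j - P j i) / 2)" for t
  define r where "r l m j = s l m j - 4 * (enriched_grad \<alpha> \<beta> (\<lambda>_. 0) (midpoint (v l) (v m)) \<bullet> \<gamma> l m j)" for l m j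
  define solves where "solves l m c \<longleftrightarrow> (\<Sum>n\<in>{..3} - {l, m}. c n *\<^sub>R glam n) \<bullet> \<gamma> l m 0 = r l m 0
      \<and> (\<Sum>n\<in>{..3} - {l, m}. c n *\<^sub>R glam n) \<bullet> \<gamma> l m 1 = r l m 1" for l m c
  define c where "c l m = (SOME c. solves l m c)" for l m
  have c: "solves l m (c l m)" if lm: "l < m" "m \<le> 3" for l m
  proof -
    have "\<exists>c. solves l m c"
      unfolding solves_def
      by (rule edge_combination_exists[OF lm perp[OF lm] perp[OF lm]]) (use indep[OF lm] in auto)
    then show ?thesis unfolding c_def by (rule someI_ex)
  qed
  define \<kappa> where "\<kappa> t = (case t of (l, m, n) \<Rightarrow> c l m n)" for t
  define z where "z = restr Int_T (enriched \<alpha> \<beta> \<kappa>)"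
  have "dofs v \<gamma> z = y"
  proof (rule target)
    fix k :: nat assume k: "k \<le> 3"
    have "enriched_grad \<alpha> \<beta> \<kappa> (v k) - G k = 0"
    proof (rule eq_0_if_orthogonal_to_edges[OF k])
      fix m :: nat assume m: "m \<le> 3" "m \<noteq> k"
      have "(v m - v k) \<bullet> enriched_grad \<alpha> \<beta> \<kappa> (v k) = P k m - 2 * f k"
        using enriched_grad_vertex[of k m \<alpha> \<beta> \<kappa>] k m
        by (cases "k < m") (simp_all add: \<alpha>_def \<beta>_def min_def max_def field_simps)
      then show "(v m - v k) \<bullet> (enriched_grad \<alpha> \<beta> \<kappa> (v k) - G k) = 0"
        by (simp add: P_def inner_diff_right)
    qed
    then show "bd_val v z (v k) = f k \<and> bd_grad v z (v k) = G k"
      using bd_vertex[OF k] by (simp add: z_def \<alpha>_def)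
  next
    fix l m j :: nat assume lm: "l < m" "m \<le> 3" "j \<le> 1"
    have "j = 0 \<or> j = 1" using lm(3) by linarith
    then have "(\<Sum>n\<in>{..3} - {l, m}. c l m n *\<^sub>R glam n) \<bullet> \<gamma> l m j = r l m j"
      using c[OF lm(1,2)] unfolding solves_def by auto
    then show "edge_dof v \<gamma> z l m j = s l m j"
      unfolding z_def edge_dof_enriched[OF lm(1,2)] by (simp add: \<kappa>_def r_def)
  qed
  moreover have "z \<in> Z3e v" by (auto simp: z_def Z3e_eq)
  ultimately show ?thesis by blast
qed

text \<open>Vertices and edge midpoints have, for every \<open>i\<close>, a vanishing coordinate with an index other than \<open>i\<close>;
  there the lift from the face \<open>f\<^sub>i\<close> is flat.\<close>

lemma dofs_R_T:
  assumes "z \<in> Z3e v"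
  shows "dofs v \<gamma> (R_T v z) = dofs v \<gamma> z"
  unfolding dofs_eq_iff
proof (intro conjI allI impI)
  fix k :: nat assume k: "k \<le> 3"
  have "\<exists>j\<le>3. j \<noteq> i \<and> bary v j (v k) = 0" if "i \<le> 3" for i
    using exists_fourth_index[of i k k] k by (auto simp: bary_vertex)
  then show "bd_val v (R_T v z) (v k) = bd_val v z (v k)" "bd_grad v (R_T v z) (v k) = bd_grad v z (v k)"
    using R_T_jet[OF assms vertex_in_tet[OF k]] by blast+
next
  fix l m j :: nat assume lm: "l < m" "m \<le> 3" "j \<le> 1"
  have "\<exists>j\<le>3. j \<noteq> i \<and> bary v j (midpoint (v l) (v m)) = 0" if "i \<le> 3" for i
    using exists_fourth_index[of i l m] lm by (auto simp: bary_vertex bary_midpoint)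
  then have "bd_grad v (R_T v z) (midpoint (v l) (v m)) = bd_grad v z (midpoint (v l) (v m))"
    using R_T_jet(2)[OF assms midpoint_in_tet] lm by simp
  then show "edge_dof v \<gamma> (R_T v z) l m j = edge_dof v \<gamma> z l m j"
    by (simp add: edge_dof_def)
qed

lemma subspace_Z3sing: "subspace (Z3sing v)"
  unfolding Z3sing_def
proof (rule subspaceI)
  show "0 \<in> R_T v ` Z3e v"
    using R_T_linear[of 0 0 0 0] subspace_0[OF subspace_Z3e] by force
next
  fix f g assume "f \<in> R_T v ` Z3e v" "g \<in> R_T v ` Z3e v"
  then obtain z w where "z \<in> Z3e v" "w \<in> Z3e v" "f = R_T v z" "g = R_T v w" by blast
  then show "f + g \<in> R_T v ` Z3e v"
    using R_T_linear[of z w 1 1] subspace_add[OF subspace_Z3e, of z w] by force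
next
  fix c :: real and f assume "f \<in> R_T v ` Z3e v"
  then obtain z where "z \<in> Z3e v" "f = R_T v z" by blast
  then show "c *\<^sub>R f \<in> R_T v ` Z3e v"
    using R_T_linear[of z z c 0] subspace_scale[OF subspace_Z3e, of z c] by force
qed

lemma dofs_linear_Z3sing:
  assumes "f \<in> Z3sing v" "g \<in> Z3sing v"
  shows "dofs v \<gamma> (a *\<^sub>R f + b *\<^sub>R g) = a *\<^sub>R dofs v \<gamma> f + b *\<^sub>R dofs v \<gamma> g"
proof -
  obtain z w where zw: "z \<in> Z3e v" "w \<in> Z3e v" "f = R_T v z" "g = R_T v w"
    using assms by (auto simp: Z3sing_def)
  have "a *\<^sub>R z + b *\<^sub>R w \<in> Z3e v"
    using zw by (intro subspace_add subspace_scale subspace_Z3e)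
  then show ?thesis
    using zw dofs_R_T dofs_linear_Z3e[OF zw(1,2)] R_T_linear[OF zw(1,2)] by metis
qed

lemma dofs_bij_Z3sing: "bij_betw (dofs v \<gamma>) (Z3sing v) UNIV"
  unfolding bij_betw_def
proof
  show "inj_on (dofs v \<gamma>) (Z3sing v)"
    unfolding Z3sing_def using dofs_R_T inj_onD[OF dofs_inj_on_Z3e] by (intro inj_onI) force
  show "dofs v \<gamma> ` Z3sing v = UNIV"
  proof (intro equalityI subsetI UNIV_I)
    fix y
    obtain z where "z \<in> Z3e v" "dofs v \<gamma> z = y" using dofs_surj_on_Z3e by blast
    then have "dofs v \<gamma> (R_T v z) = y" "R_T v z \<in> Z3sing v"
      using dofs_R_T by (auto simp: Z3sing_def)
    then show "y \<in> dofs v \<gamma> ` Z3sing v" by blast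
  qed
qed

end

theorem lemma3p13:
  fixes v :: "nat \<Rightarrow> real^3"
    and \<gamma> :: "nat \<Rightarrow> nat \<Rightarrow> nat \<Rightarrow> real^3"
  assumes "nondegenerate v"
    and "\<And>l m j. l < m \<Longrightarrow> m \<le> 3 \<Longrightarrow> j \<le> 1 \<Longrightarrow> \<gamma> l m j \<in> edge_perp v l m"
    and "\<And>l m. l < m \<Longrightarrow> m \<le> 3 \<Longrightarrow> \<gamma> l m 0 \<noteq> \<gamma> l m 1 \<and> independent {\<gamma> l m 0, \<gamma> l m 1}"
  shows "subspace (Z3sing v)
    \<and> (\<forall>z\<in>Z3sing v. \<forall>w\<in>Z3sing v. \<forall>a b.
         dofs v \<gamma> (a *\<^sub>R z + b *\<^sub>R w) = a *\<^sub>R dofs v \<gamma> z + b *\<^sub>R dofs v \<gamma> w)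
    \<and> bij_betw (dofs v \<gamma>) (Z3sing v) UNIV
    \<and> dim (Z3sing v) = 28"
proof -
  interpret tetrahedron_with_edge_normals v \<gamma>
    by unfold_locales (fact assms)+
  have "dim (Z3sing v) = DIM(real^28)"
    by (rule dim_linear_bij[OF subspace_Z3sing dofs_linear_Z3sing dofs_bij_Z3sing])
  then show ?thesis
    using subspace_Z3sing dofs_linear_Z3sing dofs_bij_Z3sing by simp
qed

end
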